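(* Let $n\ge2$ be an integer, let $\alpha$ be a badly approximable number, and let $b\in(0,1)$ satisfy $b\ne\{m\alpha\}$ for every $m\in\mathbb{Z}$. Then every half-infinite $\alpha$-geodesic on the $n$-square-$b$ surface is uniformly distributed.
   Context: $\{z\}$ is the fractional part of $z$. A badly approximable number is an irrational real number whose continued fraction digits have a common upper bound. For an integer $n\ge 2$ and $0<b<1$, the $n$-square-$b$ surface is built from a horizontal row of $n$ unit squares $Q_\ell=[\ell-1,\ell]\times[0,1]$, $\ell=1,\dots,n$, as follows. For each $\ell$ the top edge of $Q_\ell$ is identified with its bottom edge by vertical translation. The lower part $\{\ell\}\times[0,b)$ of the right edge of $Q_\ell$ is a $b$-size gate leading into $Q_{\ell+1}$ (indices modulo $n$; the gate on the right edge of $Q_n$ is identified by horizontal translation with $\{0\}\times[0,b)$ on the left edge of $Q_1$). The upper part $\{\ell\}\times[b,1)$ is a barrier: its left side (the part of the right edge of $Q_\ell$) is identified by horizontal translation with the part $\{\ell-1\}\times[b,1)$ of the left edge of the same square $Q_\ell$. Gates and barriers are closed at the bottom end and open at the top end. A half-infinite $\alpha$-geodesic is a trajectory on this surface moving with unit speed for all times $t\ge0$ in the fixed direction $(1,\alpha)$ (slope $\alpha$). Thus, if it leaves the left edge of $Q_\ell$ at height $x\in[0,1)$, it next arrives at height $\{x+\alpha\}$ on the left edge of $Q_{\ell+1}$ (index modulo $n$) if $\{x+\alpha\}<b$, and on the left edge of $Q_\ell$ if $\{x+\alpha\}\ge b$. A half-infinite geodesic $\mathcal{L}(t)$ is uniformly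 distributed if for every Jordan measurable subset $A$ of the surface, $\lim_{T\to\infty}\frac1T|\{t\in[0,T]:\mathcal{L}(t)\in A\}|=\mathrm{area}(A)/n$. *)

theory Defs
  imports "HOL-Analysis.Analysis"
begin

text \<open>Complete quotients and digits of the continued fraction of \<open>x\<close>. Division by zero only
  occurs for rational \<open>x\<close>. The digit of index 0 is \<open>\<lfloor>x\<rfloor>\<close> and may be negative; all later
  ones are positive.\<close>

primrec complete_quotient :: "real \<Rightarrow> nat \<Rightarrow> real" where
  "complete_quotient x 0 = x"
| "complete_quotient x (Suc k) = 1 / frac (complete_quotient x k)"

definition cf_digit :: "real \<Rightarrow> nat \<Rightarrow> int" where
  "cf_digit x k = \<lfloor>complete_quotient x k\<rfloor>"

definition badly_approximable :: "real \<Rightarrow> bool" where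
  "badly_approximable x \<longleftrightarrow> x \<notin> \<rat> \<and> (\<exists>C. \<forall>k. cf_digit x k \<le> C)"

definition square :: "nat \<Rightarrow> (real \<times> real) set" where
  "square l = {real l - 1..real l} \<times> {0..1}"

text \<open>The surface is glued from the disjoint union of the closed squares: \<open>(l, p)\<close> is the point
  \<open>p\<close> regarded as a point of \<open>square l\<close>. This keeps the two sides of a barrier apart.\<close>

type_synonym square_point = "nat \<times> real \<times> real"

definition next_square :: "nat \<Rightarrow> nat \<Rightarrow> nat" where
  "next_square n l = (if l = n then 1 else l + 1)"

text \<open>Height 1 on a vertical edge is not listed under \<open>gate\<close> or \<open>barrier\<close>: gates and barriers are
  open at the top, and such points are already identified with height 0 by \<open>top_bottom\<close>.\<close>

inductive identified :: "nat \<Rightarrow> real \<Rightarrow> square_point \<Rightarrow> square_point \<Rightarrow> bool"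
  for n :: nat and b :: real where
  top_bottom: "l \<in> {1..n} \<Longrightarrow> x \<in> {real l - 1..real l} \<Longrightarrow> identified n b (l, x, 1) (l, x, 0)"
| gate: "l \<in> {1..n} \<Longrightarrow> 0 \<le> y \<Longrightarrow> y < b \<Longrightarrow>
    identified n b (l, real l, y) (next_square n l, real (next_square n l) - 1, y)"
| barrier: "l \<in> {1..n} \<Longrightarrow> b \<le> y \<Longrightarrow> y < 1 \<Longrightarrow>
    identified n b (l, real l, y) (l, real l - 1, y)"

definition surface_point :: "nat \<Rightarrow> real \<Rightarrow> square_point \<Rightarrow> square_point set" where
  "surface_point n b p = {q. equivclp (identified n b) p q}"

definition square_surface :: "nat \<Rightarrow> real \<Rightarrow> square_point set set" where
  "square_surface n b = surface_point n b ` (SIGMA l:{1..n}. square l)"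

definition unit_direction :: "real \<Rightarrow> real \<times> real" where
  "unit_direction \<alpha> = (1 / sqrt (1 + \<alpha>\<^sup>2)) *\<^sub>R (1, \<alpha>)"

text \<open>A half-infinite geodesic: just after every time \<open>t \<ge> 0\<close> and just before every time \<open>t > 0\<close>
  it is the image of a straight segment in one of the closed squares, traversed with unit speed in
  the direction of \<open>(1, \<alpha>)\<close>. The segments include their end point at time \<open>t\<close>, so on reaching an
  edge the trajectory continues from an identified boundary point. Only the values of \<open>L\<close> at
  times \<open>\<ge> 0\<close> matter.\<close>

definition half_infinite_geodesic ::
    "nat \<Rightarrow> real \<Rightarrow> real \<Rightarrow> (real \<Rightarrow> square_point set) \<Rightarrow> bool" where
  "half_infinite_geodesic n b \<alpha> L \<longleftrightarrow>
     (\<forall>t\<ge>0. \<exists>\<epsilon>>0. \<exists>l\<in>{1..n}. \<exists>p. \<forall>s\<in>{0..\<epsilon>}.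
        p + s *\<^sub>R unit_direction \<alpha> \<in> square l \<and>
        L (t + s) = surface_point n b (l, p + s *\<^sub>R unit_direction \<alpha>)) \<and>
     (\<forall>t>0. \<exists>\<epsilon>\<in>{0<..t}. \<exists>l\<in>{1..n}. \<exists>p. \<forall>s\<in>{0..\<epsilon>}.
        p - s *\<^sub>R unit_direction \<alpha> \<in> square l \<and>
        L (t - s) = surface_point n b (l, p - s *\<^sub>R unit_direction \<alpha>))"

definition square_part :: "nat \<Rightarrow> real \<Rightarrow> square_point set set \<Rightarrow> nat \<Rightarrow> (real \<times> real) set" where
  "square_part n b A l = {p \<in> square l. surface_point n b (l, p) \<in> A}"

definition jordan_measurable :: "(real \<times> real) set \<Rightarrow> bool" where
  "jordan_measurable S \<longleftrightarrow> bounded S \<and> negligible (frontier S)"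

definition surface_jordan_measurable :: "nat \<Rightarrow> real \<Rightarrow> square_point set set \<Rightarrow> bool" where
  "surface_jordan_measurable n b A \<longleftrightarrow>
     A \<subseteq> square_surface n b \<and> (\<forall>l\<in>{1..n}. jordan_measurable (square_part n b A l))"

text \<open>The squares overlap in the surface only along edges, which have area 0.\<close>

definition surface_area :: "nat \<Rightarrow> real \<Rightarrow> square_point set set \<Rightarrow> real" where
  "surface_area n b A = (\<Sum>l = 1..n. measure lebesgue (square_part n b A l))"

text \<open>A Jordan measurable set may contain an arbitrary subset of a segment, so the set of visiting
  times need not be Lebesgue measurable, in which case \<open>measure\<close> would return the junk value 0.
  Outer measure agrees with Lebesgue measure on measurable sets.\<close>

definition visiting_time :: "(real \<Rightarrow> 'a) \<Rightarrow> 'a set \<Rightarrow> real \<Rightarrow> real" where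
  "visiting_time L A T = enn2real (outer_measure_of lebesgue {t \<in> {0..T}. L t \<in> A})"

definition uniformly_distributed ::
    "nat \<Rightarrow> real \<Rightarrow> (real \<Rightarrow> square_point set) \<Rightarrow> bool" where
  "uniformly_distributed n b L \<longleftrightarrow>
     (\<forall>A. surface_jordan_measurable n b A \<longrightarrow>
        ((\<lambda>T. visiting_time L A T / T) \<longlongrightarrow> surface_area n b A / real n) at_top)"

end

theory Submission
  imports Defs
begin

text \<open>
  A geodesic is determined by its successive passages through left edges of squares. The heights form
  an orbit \<open>x + j \<alpha>\<close> of a rotation of the circle, and the number of the square increases by 1 modulo
  \<open>n\<close> exactly when the new height lies in \<open>[0, b)\<close>. So the theorem says that every orbit of this
  extension of the rotation by the cyclic group of order \<open>n\<close> is uniformly distributed.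

  Characters of the cyclic group reduce this to two facts. For the trivial character it is the uniform
  distribution of the rotation, \<open>visits_upper\<close>. For a root of unity \<open>\<omega> \<noteq> 1\<close> let \<open>c\<^sub>j(x)\<close> be \<open>\<omega>\<close> to the
  number of the points \<open>x, x + \<alpha>, \<dots>, x + (j - 1) \<alpha>\<close> in \<open>[0, b)\<close> modulo 1; then the sums of
  \<open>c\<^sub>j(x)\<close> over those \<open>j < N\<close> for which \<open>x + j \<alpha>\<close> lies in a given arc must be \<open>o(N)\<close> uniformly in \<open>x\<close>
  (\<open>twisted_sum_small\<close>).

  Suppose that these sums had size \<open>M N\<close> with \<open>M > 0\<close>. A sum of a large fixed length \<open>K\<close>, divided by \<open>K\<close>,
  then behaves like a transfer function: multiplied by the cocycle, it is almost constant along orbits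
  on which much longer sums are nearly extremal. Being a step function, it hardly changes
  under the rotation by \<open>q \<alpha>\<close> if \<open>q \<alpha>\<close> is nearly an integer. Hence \<open>c\<^sub>q\<close> is close to 1 on most of the orbit
  (\<open>cocycle_nearly_trivial\<close>). But \<open>c\<^sub>q\<close> jumps by the factor \<open>\<omega>\<close> at each of the points \<open>- i \<alpha>\<close>, \<open>i < q\<close>,
  and by its inverse at the points \<open>b - i \<alpha>\<close>. For badly approximable \<open>\<alpha>\<close> either family of points is
  separated by a constant multiple of \<open>1 / q\<close>, so that almost every \<open>- i \<alpha>\<close> must be very close to some
  \<open>b - i' \<alpha>\<close> (\<open>isolated_discontinuities_le\<close>). By the separation, \<open>i' - i\<close> is a constant \<open>m\<close>, it is small
  compared with \<open>q\<close>, and \<open>b\<close> is close to \<open>m \<alpha>\<close> modulo 1 (\<open>small_shift\<close>). Suitable \<open>q\<close> exist at all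
  scales, between \<open>c N\<close> and \<open>N\<close> for every \<open>N\<close> with a fixed \<open>c > 0\<close>, and the separation makes the shifts \<open>m\<close> of
  neighbouring scales equal.
  So \<open>m\<close> does not depend on \<open>q\<close>, and \<open>b\<close> is equal to \<open>m \<alpha>\<close> modulo 1, which is
  excluded (\<open>shifts_at_all_scales_imp_frac\<close>).

  To return to the surface, a Jordan measurable set is covered by small cells whose total area is
  close to its own. The time that a geodesic spends in a cell is bounded by counting visits to an arc,
  which gives the upper bound for the visiting frequency; the complement gives the lower bound.
\<close>

section \<open>Bad approximability and continued fraction digits\<close>

lemma complete_quotient_shift: "complete_quotient x (Suc k) = complete_quotient (1 / frac x) k"
  by (induction k) simp_all

text \<open>The form \<open>(q x - p) (q y + p) / (x + y)\<close> keeps its absolute value when \<open>x\<close> is replaced by the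
  complete quotient \<open>x' = 1 / (x - a)\<close> with \<open>a = \<lfloor>x\<rfloor>\<close>, \<open>y\<close> by \<open>1 / (y + a)\<close> and \<open>(q, p)\<close> by
  \<open>(p - a q, q)\<close>. As long as \<open>p / q\<close> lies strictly between \<open>a\<close> and \<open>a + 1\<close> this step decreases \<open>q\<close>;
  when it does not, \<open>p / q\<close> is separated from \<open>x\<close> by \<open>a\<close> or \<open>a + 1\<close> and the bound on the complete
  quotients keeps \<open>x\<close> away from both integers. The second variable \<open>y\<close> makes the descent exact, so
  that no loss accumulates over the steps.\<close>

lemma complete_quotient_indefinite_form:
  fixes x y C :: real and q p :: nat
  assumes "x \<notin> \<rat>" and "1 < x" and "\<And>k. complete_quotient x k \<le> C"
    and "0 \<le> y" and "y \<le> 1" and "1 \<le> q" and "1 \<le> p"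
  shows "(x + y) / (2 * (C + 1)) \<le> \<bar>(q * x - p) * (q * y + p)\<bar>"
  using assms
proof (induction q arbitrary: x y p rule: less_induct)
  case (less q)
  define a where "a = nat \<lfloor>x\<rfloor>"
  define f where "f = frac x"
  define x' where "x' = 1 / f"
  have a: "real a = of_int \<lfloor>x\<rfloor>" "1 \<le> a"
    using less.prems(2) unfolding a_def by (auto simp: le_nat_iff)
  have xaf: "x = a + f"
    unfolding f_def frac_def a(1) by simp
  have f0: "0 < f" and f1: "f < 1"
    using less.prems(1) frac_lt_1[of x] unfolding f_def by (auto simp: frac_gt_0_iff Ints_subset_Rats[THEN subsetD])
  have x'_irr: "x' \<notin> \<rat>"
  proof
    assume "x' \<in> \<rat>"
    then have "1 / x' \<in> \<rat>" by (intro Rats_divide) auto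
    then have "a + f \<in> \<rat>" unfolding x'_def using f0 by auto
    then show False using less.prems(1) xaf by simp
  qed
  have x'1: "1 < x'" unfolding x'_def using f0 f1 by simp
  have cq: "complete_quotient x' k \<le> C" for k
    using less.prems(3)[of "Suc k"] unfolding x'_def f_def complete_quotient_shift .
  have x'C: "x' \<le> C" using cq[of 0] by simp
  then have C1: "1 < C" using x'1 by simp
  have fC: "1 \<le> C * f" using x'C f0 unfolding x'_def by (simp add: field_simps)
  \<comment> \<open>A fractional part close to 1 would give a digit 1 followed by a large digit.\<close>
  have f1C: "f \<le> C * (1 - f)"
  proof (cases "f \<le> 1 / 2")
    case True
    have "f \<le> 1 * (1 - f)" using True by simp
    also have "\<dots> \<le> C * (1 - f)" by (rule mult_right_mono) (use C1 f1 in auto)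
    finally show ?thesis .
  next
    case False
    have fl: "\<lfloor>x'\<rfloor> = 1"
      unfolding x'_def using False f0 f1 by (intro floor_unique) (auto simp: field_simps)
    have "complete_quotient x' 1 = f / (1 - f)"
      unfolding One_nat_def complete_quotient.simps frac_def fl
      unfolding x'_def using f0 f1 by (simp add: field_simps)
    then have "f / (1 - f) \<le> C" using cq[of 1] by simp
    then show ?thesis using f1 by (simp add: field_simps)
  qed
  have pos: "0 < x + y" using less.prems by simp
  have q1: "1 \<le> real q" and p1: "1 \<le> real p" using less.prems by auto
  have le_half: "(x + y) / (2 * (C + 1)) \<le> (x + y) / 2"
    using C1 pos by (intro divide_left_mono) auto
  consider "p < a * q" | "p = a * q" | "a * q < p" "p < (a + 1) * q" | "(a + 1) * q \<le> p"
    by linarith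
  then show ?case
  proof cases
    case 1
    have "real p + 1 \<le> a * q" using 1 by (metis Suc_eq_plus1 Suc_leI of_nat_Suc of_nat_le_iff of_nat_mult add.commute)
    moreover have "0 \<le> q * f" using f0 by simp
    ultimately have u: "1 \<le> q * x - p" unfolding xaf by (simp add: algebra_simps)
    have v: "1 \<le> q * y + p" using p1 less.prems(4) by (simp add: add_increasing)
    have "0 \<le> (q * x - p - 1) * (q * y + p - 1)" using u v by simp
    then have prod: "q * (x + y) - 1 \<le> (q * x - p) * (q * y + p)" by (simp add: algebra_simps)
    have "(x + y) / 2 \<le> q * (x + y) - 1"
    proof (cases "q = 1")
      case True
      then have "2 \<le> a" using 1 less.prems(7) by simp
      then have "2 \<le> x" using xaf f0 by simp
      then show ?thesis using True less.prems(4) by simp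
    next
      case False
      then have "2 \<le> real q" using q1 by simp
      then have "2 * (x + y) \<le> q * (x + y)" using pos by (intro mult_right_mono) auto
      then show ?thesis using less.prems(2,4) by simp
    qed
    then show ?thesis using prod le_half by linarith
  next
    case 2
    have "(q * x - p) * (q * y + p) = (q * q) * (f * (y + a))"
      unfolding 2 xaf by (simp add: algebra_simps)
    moreover have "1 * (f * (y + a)) \<le> (q * q) * (f * (y + a))"
      using mult_mono[of 1 "real q" 1 "real q"] q1 f0 less.prems(4) by (intro mult_right_mono) auto
    moreover have "(x + y) / (2 * (C + 1)) \<le> f * (y + a)"
    proof -
      have "x + y \<le> 2 * (1 * (y + a))" using xaf f1 a(2) less.prems(4) by simp
      also have "\<dots> \<le> 2 * ((C * f + f) * (y + a))"
        using fC f0 a less.prems(4) by (intro mult_left_mono mult_right_mono) auto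
      also have "\<dots> = (f * (y + a)) * (2 * (C + 1))" by (simp add: algebra_simps)
      finally show ?thesis using C1 by (simp add: pos_divide_le_eq)
    qed
    ultimately show ?thesis by simp
  next
    case 3
    define p' where "p' = p - a * q"
    define y' where "y' = 1 / (y + a)"
    have pp: "real p = p' + a * q" unfolding p'_def using 3 by (simp add: of_nat_diff)
    have ya: "1 \<le> y + a" using a less.prems(4) by simp
    have "p' < q" "1 \<le> p'" using 3 unfolding p'_def by auto
    from less.IH[OF this(1) x'_irr x'1 cq _ _ this(2) less.prems(6), of y']
    have IH: "(x' + y') / (2 * (C + 1)) \<le> \<bar>(p' * x' - q) * (p' * y' + q)\<bar>"
      using ya unfolding y'_def by simp
    have y'0: "0 < y'" using ya unfolding y'_def by simp
    \<comment> \<open>The substitution \<open>x = a + 1/x'\<close>, \<open>y' = 1/(y + a)\<close> preserves the normalized form.\<close>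
    have A: "(q * x - p) * (q * y + p) = - ((p' * x' - q) * (p' * y' + q)) / (x' * y')"
    proof -
      have "q * x - p = - (p' * x' - q) / x'"
        unfolding pp xaf x'_def using f0 by (simp add: field_simps)
      moreover have "q * y + p = (p' * y' + q) / y'"
        unfolding pp y'_def using ya by (simp add: field_simps)
      ultimately show ?thesis by (simp only: times_divide_times_eq mult_minus_left)
    qed
    have B: "x + y = (x' + y') / (x' * y')"
    proof -
      have "x + y = 1 / x' + 1 / y'" unfolding xaf x'_def y'_def by simp
      also have "\<dots> = (x' + y') / (x' * y')" using x'1 y'0 by (simp add: field_simps)
      finally show ?thesis .
    qed
    have "(x + y) / (2 * (C + 1)) = (x' + y') / (2 * (C + 1)) / (x' * y')"
      unfolding B by simp
    also have "\<dots> \<le> \<bar>(p' * x' - q) * (p' * y' + q)\<bar> / (x' * y')"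
      using IH x'1 y'0 by (intro divide_right_mono) auto
    also have "\<dots> = \<bar>(q * x - p) * (q * y + p)\<bar>"
      unfolding A using x'1 y'0 by (simp add: abs_mult)
    finally show ?thesis .
  next
    case 4
    have p4: "(a + 1) * real q \<le> p" using 4 by (metis of_nat_1 of_nat_add of_nat_le_iff of_nat_mult)
    have "1 * (1 - f) \<le> q * (1 - f)" using q1 f1 by (intro mult_right_mono) auto
    also have "\<dots> \<le> p - q * x" using p4 unfolding xaf by (simp add: algebra_simps)
    finally have u: "1 - f \<le> p - q * x" by simp
    have "1 * (x + y) \<le> q * (a + 1 + y)"
      using q1 xaf f0 f1 less.prems(4) by (intro mult_mono) auto
    also have "\<dots> \<le> q * y + p" using p4 by (simp add: algebra_simps)
    finally have v: "x + y \<le> q * y + p" by simp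
    have "1 / (C + 1) \<le> 1 - f" using f1C C1 by (simp add: field_simps)
    then have "(x + y) / (2 * (C + 1)) \<le> (1 - f) * (x + y)"
    proof -
      have "(x + y) / (2 * (C + 1)) \<le> (x + y) / (C + 1)"
        using C1 pos by (intro divide_left_mono) auto
      also have "\<dots> = 1 / (C + 1) * (x + y)" by simp
      also have "\<dots> \<le> (1 - f) * (x + y)"
        using \<open>1 / (C + 1) \<le> 1 - f\<close> pos by (intro mult_right_mono) auto
      finally show ?thesis .
    qed
    also have "\<dots> \<le> (p - q * x) * (q * y + p)"
      using u v f1 pos by (intro mult_mono) auto
    also have "\<dots> \<le> \<bar>(q * x - p) * (q * y + p)\<bar>"
      by (metis abs_ge_minus_self minus_diff_eq mult_minus_left)
    finally show ?thesis .
  qed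
qed

text \<open>For \<open>f = frac \<alpha>\<close> and \<open>x = 1 / f\<close> the identity \<open>q f - p = - f (p x - q)\<close> expresses the quantity to be bounded
  by the indefinite form in \<open>x\<close> with \<open>y = 0\<close>, whose value at \<open>(p, q)\<close> is \<open>(p x - q) q\<close>.\<close>

theorem badly_approximable_lower_bound:
  assumes "badly_approximable \<alpha>"
  obtains c :: real where "0 < c"
    and "\<And>m k :: int. m \<noteq> 0 \<Longrightarrow> c / \<bar>of_int m\<bar> \<le> \<bar>of_int m * \<alpha> - of_int k\<bar>"
proof -
  obtain C where irr: "\<alpha> \<notin> \<rat>" and C: "\<And>k. cf_digit \<alpha> k \<le> C"
    using assms unfolding badly_approximable_def by blast
  define f where "f = frac \<alpha>"
  define x where "x = 1 / f"
  define D where "D = real_of_int C + 1"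
  have f0: "0 < f" and f1: "f < 1"
    using irr frac_lt_1[of \<alpha>] unfolding f_def by (auto simp: frac_gt_0_iff Ints_subset_Rats[THEN subsetD])
  have x_irr: "x \<notin> \<rat>"
  proof
    assume "x \<in> \<rat>"
    then have "1 / x \<in> \<rat>" by (intro Rats_divide) auto
    then have "f \<in> \<rat>" unfolding x_def using f0 by auto
    then have "f + of_int \<lfloor>\<alpha>\<rfloor> \<in> \<rat>" by (intro Rats_add) auto
    then show False using irr unfolding f_def frac_def by simp
  qed
  have x1: "1 < x" unfolding x_def using f0 f1 by simp
  have cq: "complete_quotient x k \<le> D" for k
    using C[of "Suc k"] unfolding x_def f_def D_def cf_digit_def complete_quotient_shift by linarith
  have D1: "1 < D" using x1 cq[of 0] by simp
  define c where "c = min f (1 / (2 * (D + 1)))"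
  have c0: "0 < c" unfolding c_def using f0 D1 by simp
  have nat_case: "c / q \<le> \<bar>q * \<alpha> - of_int k\<bar>" if "1 \<le> q" for q :: nat and k :: int
  proof -
    define p where "p = k - int q * \<lfloor>\<alpha>\<rfloor>"
    have eq: "q * \<alpha> - of_int k = q * f - p"
      unfolding p_def f_def frac_def by (simp add: algebra_simps)
    have q1: "1 \<le> real q" using that by simp
    show ?thesis
    proof (cases "p \<le> 0")
      case True
      have "c / q \<le> c / 1" using q1 c0 by (intro divide_left_mono) auto
      also have "\<dots> \<le> 1 * f" unfolding c_def by simp
      also have "\<dots> \<le> q * f" using q1 f0 by (intro mult_right_mono) auto
      also have "\<dots> \<le> q * f - p" using True by simp
      finally show ?thesis unfolding eq by simp
    next
      case False
      define r where "r = nat p"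
      have r: "1 \<le> r" "real_of_int p = r" using False unfolding r_def by auto
      have "x / (2 * (D + 1)) \<le> \<bar>(r * x - q) * q\<bar>"
        using complete_quotient_indefinite_form[OF x_irr x1 cq _ _ r(1) that, of 0] by simp
      then have "f * (x / (2 * (D + 1))) \<le> f * \<bar>(r * x - q) * q\<bar>"
        using f0 by (intro mult_left_mono) auto
      also have "f * \<bar>(r * x - q) * q\<bar> = \<bar>f * (r * x - q)\<bar> * q"
        using f0 by (simp add: abs_mult)
      also have "f * (r * x - q) = - (q * f - r)"
        unfolding x_def using f0 by (simp add: field_simps)
      finally have "1 / (2 * (D + 1)) \<le> \<bar>q * f - r\<bar> * q"
        unfolding x_def using f0 by (simp add: abs_minus_commute)
      then have "c \<le> \<bar>q * f - r\<bar> * q" unfolding c_def by linarith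
      then show ?thesis unfolding eq r(2) using q1 by (simp add: field_simps)
    qed
  qed
  have "c / \<bar>of_int m\<bar> \<le> \<bar>of_int m * \<alpha> - of_int k\<bar>" if "m \<noteq> 0" for m k :: int
  proof (cases "m > 0")
    case True
    then show ?thesis using nat_case[of "nat m" k] by simp
  next
    case False
    then show ?thesis using nat_case[of "nat (- m)" "- k"] that by (simp add: abs_minus_commute)
  qed
  with c0 show thesis by (rule that)
qed

section \<open>Uniform distribution of the rotation\<close>

lemma card_separated_le:
  fixes f :: "'a \<Rightarrow> real"
  assumes "0 < d" and "0 \<le> l"
    and range: "\<And>i. i \<in> J \<Longrightarrow> 0 \<le> f i \<and> f i < l"
    and sep: "\<And>i j. i \<in> J \<Longrightarrow> j \<in> J \<Longrightarrow> i \<noteq> j \<Longrightarrow> d \<le> \<bar>f i - f j\<bar>"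
  shows "real (card J) \<le> l / d + 1"
proof -
  have "inj_on (\<lambda>i. \<lfloor>f i / d\<rfloor>) J"
  proof (rule inj_onI, rule ccontr)
    fix i j assume ij: "i \<in> J" "j \<in> J" "\<lfloor>f i / d\<rfloor> = \<lfloor>f j / d\<rfloor>" "i \<noteq> j"
    then have "\<bar>f i / d - f j / d\<bar> < 1" by linarith
    then have "\<bar>f i - f j\<bar> / d < 1" using \<open>0 < d\<close> by (simp add: abs_divide flip: diff_divide_distrib)
    then show False using sep[OF ij(1,2,4)] \<open>0 < d\<close> by (simp add: field_simps)
  qed
  moreover have "(\<lambda>i. \<lfloor>f i / d\<rfloor>) ` J \<subseteq> {0..\<lfloor>l / d\<rfloor>}"
    using range \<open>0 < d\<close> by (force intro: floor_mono divide_right_mono)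
  ultimately have "card J \<le> card {0..\<lfloor>l / d\<rfloor>}"
    by (intro card_inj_on_le) auto
  moreover have "real (nat (\<lfloor>l / d\<rfloor> + 1)) \<le> l / d + 1"
    using assms(1,2) by (simp add: nat_add_distrib)
  ultimately show ?thesis by simp
qed

lemma frac_add_nonneg_le: "0 \<le> e \<Longrightarrow> frac (z + e) \<le> frac z + (e :: real)"
  unfolding frac_def by (simp add: floor_mono)

lemma frac_diff_Ints: "\<exists>k :: int. frac x - frac y = x - y - of_int k"
  by (rule exI[of _ "\<lfloor>x\<rfloor> - \<lfloor>y\<rfloor>"]) (simp add: frac_def)

text \<open>If the answer changed, then an integer or an integer translate of \<open>l\<close> would lie between \<open>z\<close> and \<open>z + e\<close>.\<close>

lemma frac_less_perturb:
  fixes z e l d :: real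
  assumes "0 \<le> l" and "l \<le> 1" and e: "\<bar>e\<bar> \<le> d"
    and z: "\<And>k :: int. d < \<bar>z - of_int k\<bar>" and zl: "\<And>k :: int. d < \<bar>z - l - of_int k\<bar>"
  shows "frac (z + e) < l \<longleftrightarrow> frac z < l"
proof -
  have r: "d < frac z" "d < 1 - frac z" "d < \<bar>frac z - l\<bar>"
    using z[of "\<lfloor>z\<rfloor>"] z[of "\<lfloor>z\<rfloor> + 1"] zl[of "\<lfloor>z\<rfloor>"] frac_ge_0[of z] frac_lt_1[of z]
    unfolding frac_def by (auto simp: algebra_simps)
  have "\<lfloor>z + e\<rfloor> = \<lfloor>z\<rfloor>"
    using r(1,2) e unfolding frac_def by (intro floor_unique) auto
  then have "frac (z + e) = frac z + e" unfolding frac_def by simp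
  then show ?thesis using r(3) e by auto
qed

text \<open>Arcs of the circle are given as \<open>{y. frac (y - s) < l}\<close>, so the starting point of the orbit can be
  absorbed into \<open>s\<close>, and statements that are uniform in \<open>s\<close> are uniform in the orbit.\<close>

definition visits :: "real \<Rightarrow> real \<Rightarrow> real \<Rightarrow> nat \<Rightarrow> nat" where
  "visits \<alpha> s l N = card {j. j < N \<and> frac (real j * \<alpha> - s) < l}"

lemma visits_add: "visits \<alpha> s l (N + K) = visits \<alpha> s l N + visits \<alpha> (s - real N * \<alpha>) l K"
proof -
  have "{j. j < N + K \<and> frac (real j * \<alpha> - s) < l} =
      {j. j < N \<and> frac (real j * \<alpha> - s) < l} \<union>
      (\<lambda>j. N + j) ` {j. j < K \<and> frac (real j * \<alpha> - (s - real N * \<alpha>)) < l}" (is "?A = ?B \<union> ?f ` ?C")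
  proof (intro set_eqI iffI)
    fix j assume j: "j \<in> ?A"
    show "j \<in> ?B \<union> ?f ` ?C"
    proof (cases "j < N")
      case False
      then have "j = N + (j - N)" "real j = real N + real (j - N)" by auto
      then show ?thesis using j False by (intro UnI2 image_eqI[of _ _ "j - N"]) (auto simp: algebra_simps)
    qed (use j in auto)
  qed (auto simp: algebra_simps)
  moreover have "?B \<inter> ?f ` ?C = {}" by auto
  ultimately show ?thesis
    unfolding visits_def by (simp add: card_Un_disjoint card_image)
qed

lemma visits_mono: "N \<le> K \<Longrightarrow> visits \<alpha> s l N \<le> visits \<alpha> s l K"
  unfolding visits_def by (rule card_mono) auto

lemma visits_complement:
  assumes "0 \<le> l" and "l \<le> 1"
  shows "visits \<alpha> s l N + visits \<alpha> (s + l) (1 - l) N = N"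
proof -
  have iff: "frac (z - l) < 1 - l \<longleftrightarrow> \<not> frac z < l" for z
  proof (cases "frac z < l")
    case True
    have "z - l - (frac z - l + 1) \<in> \<int>" by (simp add: frac_def)
    moreover have "0 \<le> frac z - l + 1" "frac z - l + 1 < 1"
      using True assms frac_ge_0[of z] by linarith+
    ultimately have "frac (z - l) = frac z - l + 1" unfolding frac_unique_iff by simp
    then have "\<not> frac (z - l) < 1 - l" using frac_ge_0[of z] by linarith
    then show ?thesis using True by blast
  next
    case False
    have "frac (z - l) = frac z - l"
      unfolding frac_unique_iff using False assms frac_lt_1[of z] by (auto simp: frac_def)
    then show ?thesis using False frac_lt_1[of z] by auto
  qed
  have "visits \<alpha> (s + l) (1 - l) N = card {j. j < N \<and> \<not> frac (real j * \<alpha> - s) < l}"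
    unfolding visits_def diff_diff_eq[symmetric] iff ..
  moreover have "{..<N} = {j. j < N \<and> frac (real j * \<alpha> - s) < l} \<union>
      {j. j < N \<and> \<not> frac (real j * \<alpha> - s) < l}" (is "_ = ?A \<union> ?B") by auto
  then have "N = card (?A \<union> ?B)" by (metis card_lessThan)
  then have "N = card ?A + card ?B" by (subst (asm) card_Un_disjoint) auto
  ultimately show ?thesis unfolding visits_def by simp
qed

text \<open>During \<open>q\<close> steps the orbit stays within distance \<open>1 / q\<close> of the \<open>q\<close> equally spaced points
  of the rotation by \<open>p / q\<close>.\<close>

lemma visits_block_le:
  fixes p q :: int
  assumes "coprime p q" and "0 < q" and approx: "\<bar>of_int q * \<alpha> - of_int p\<bar> \<le> 1 / of_int q" and "0 \<le> l"
  shows "real (visits \<alpha> s l (nat q)) \<le> l * of_int q + 3"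
proof -
  define Q where "Q = real_of_int q"
  define P where "P = real_of_int p"
  have Q0: "0 < Q" and Q: "real (nat q) = Q" using \<open>0 < q\<close> unfolding Q_def by auto
  define J where "J = {j. j < nat q \<and> frac (real j * \<alpha> - s) < l}"
  define y where "y j = real j * (P / Q) - s + 1 / Q" for j :: nat
  have "real (card J) \<le> (l + 2 / Q) / (1 / Q) + 1"
  proof (rule card_separated_le[where f = "\<lambda>j. frac (y j)"])
    fix j assume j: "j \<in> J"
    define e where "e = 1 / Q - real j * (\<alpha> - P / Q)"
    have "real j \<le> Q" using j Q unfolding J_def by (simp flip: Q)
    then have "\<bar>real j * (\<alpha> - P / Q)\<bar> \<le> Q * \<bar>\<alpha> - P / Q\<bar>"
      by (simp add: abs_mult mult_right_mono)
    also have "\<dots> = \<bar>Q * (\<alpha> - P / Q)\<bar>" using Q0 by (simp add: abs_mult)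
    also have "Q * (\<alpha> - P / Q) = Q * \<alpha> - P" using Q0 by (simp add: field_simps)
    also have "\<bar>Q * \<alpha> - P\<bar> \<le> 1 / Q" using approx unfolding Q_def P_def .
    finally have e: "0 \<le> e" "e \<le> 2 / Q" unfolding e_def by auto
    have "y j = (real j * \<alpha> - s) + e" unfolding y_def e_def by (simp add: algebra_simps)
    then have "frac (y j) \<le> frac (real j * \<alpha> - s) + e" using frac_add_nonneg_le[OF e(1)] by simp
    also have "\<dots> < l + 2 / Q" using j e(2) unfolding J_def by auto
    finally show "0 \<le> frac (y j) \<and> frac (y j) < l + 2 / Q" by simp
  next
    fix i j assume ij: "i \<in> J" "j \<in> J" "i \<noteq> j"
    obtain k where k: "frac (y i) - frac (y j) = y i - y j - of_int k" using frac_diff_Ints by blast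
    have "y i - y j - of_int k = of_int ((int i - int j) * p - k * q) / Q"
      unfolding y_def Q_def P_def using \<open>0 < q\<close> by (simp add: field_simps)
    moreover have "(int i - int j) * p - k * q \<noteq> 0"
    proof
      assume "(int i - int j) * p - k * q = 0"
      then have "q dvd (int i - int j) * p" by (metis dvd_triv_right eq_iff_diff_eq_0)
      then have "q dvd int i - int j"
        using \<open>coprime p q\<close> by (simp add: coprime_commute coprime_dvd_mult_left_iff)
      moreover have "\<bar>int i - int j\<bar> < q" using ij unfolding J_def by auto
      ultimately show False using ij(3) zdvd_imp_le[of q "\<bar>int i - int j\<bar>"] by auto
    qed
    then have "1 \<le> \<bar>(int i - int j) * p - k * q\<bar>" by linarith
    then have "1 \<le> real_of_int \<bar>(int i - int j) * p - k * q\<bar>" by linarith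
    ultimately show "1 / Q \<le> \<bar>frac (y i) - frac (y j)\<bar>"
      unfolding k using Q0 by (simp add: abs_divide divide_right_mono)
  qed (use Q0 \<open>0 \<le> l\<close> in auto)
  also have "\<dots> = l * Q + 3" using Q0 by (simp add: field_simps)
  finally show ?thesis unfolding visits_def J_def Q_def .
qed

lemma visits_blocks_le:
  assumes "\<And>s. real (visits \<alpha> s l q) \<le> B"
  shows "real (visits \<alpha> s l (t * q)) \<le> t * B"
proof (induction t arbitrary: s)
  case (Suc t)
  have "real (visits \<alpha> s l (q + t * q)) \<le> B + t * B"
    unfolding visits_add using assms[of s] Suc.IH[of "s - real q * \<alpha>"] by simp
  then show ?case by (simp add: algebra_simps)
qed (simp add: visits_def)

text \<open>The whole arithmetic of \<open>\<alpha>\<close> enters through this inequality: \<open>N\<close> consecutive points of an orbit are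
  pairwise at distance at least \<open>c / N\<close> on the circle.\<close>

locale badly_approximable_rotation =
  fixes \<alpha> c :: real
  assumes c_pos: "0 < c"
    and separation: "\<And>m k :: int. m \<noteq> 0 \<Longrightarrow> c / \<bar>of_int m\<bar> \<le> \<bar>of_int m * \<alpha> - of_int k\<bar>"
begin

lemma separation_le:
  assumes "m \<noteq> 0" and "\<bar>of_int m\<bar> \<le> B"
  shows "c / B \<le> \<bar>of_int m * \<alpha> - of_int k\<bar>"
proof -
  have "c / B \<le> c / \<bar>of_int m\<bar>" using assms c_pos by (intro divide_left_mono mult_pos_pos) auto
  then show ?thesis using separation[OF assms(1)] by (meson order_trans)
qed

text \<open>Dirichlet's theorem supplies good denominators below every bound; the lower bound on the
  approximation quality forces them to be large.\<close>

lemma good_denominator: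
  assumes "0 < (N :: nat)"
  obtains p q :: int where "coprime p q" and "0 < q" and "c * N \<le> of_int q" and "of_int q \<le> real N"
    and "\<bar>of_int q * \<alpha> - of_int p\<bar> < 1 / N"
proof -
  obtain p q where pq: "coprime p q" "0 < q" "q \<le> int N" "\<bar>of_int q * \<alpha> - of_int p\<bar> < 1 / N"
    using Dirichlet_approx_coprime[OF assms] by blast
  have "c / of_int q \<le> \<bar>of_int q * \<alpha> - of_int p\<bar>"
    using separation[of q p] pq(2) by simp
  then have "c / of_int q < 1 / N" using pq(4) by linarith
  then have "c * N \<le> of_int q" using assms pq(2) by (simp add: field_simps)
  moreover have "of_int q \<le> real N" using pq(3) by (metis of_int_le_iff of_int_of_nat_eq)
  ultimately show thesis using pq by (intro that) auto
qed

text \<open>Cut the orbit into blocks whose length is a good denominator \<open>q\<close>, so large that the error of 3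
  visits per block is negligible.\<close>

lemma visits_upper:
  assumes "0 \<le> l" and "0 < \<epsilon>"
  shows "\<exists>N0. \<forall>N\<ge>N0::nat. \<forall>s. real (visits \<alpha> s l N) \<le> (l + \<epsilon>) * N"
proof -
  obtain n :: nat where n: "6 / (\<epsilon> * c) < n" using reals_Archimedean2 by blast
  have "0 < 6 / (\<epsilon> * c)" using assms(2) c_pos by simp
  then have n0: "0 < real n" using n by linarith
  then have "0 < n" by simp
  then obtain p q where pq: "coprime p q" "0 < q" "c * n \<le> of_int q" "of_int q \<le> real n"
    "\<bar>of_int q * \<alpha> - of_int p\<bar> < 1 / n"
    using good_denominator by blast
  define Q where "Q = real_of_int q"
  have Q0: "0 < Q" and Q: "real (nat q) = Q" using pq(2) unfolding Q_def by auto
  have "6 < \<epsilon> * (c * n)" using n assms(2) c_pos by (simp add: field_simps)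
  also have "\<dots> \<le> \<epsilon> * Q" using pq(3) assms(2) unfolding Q_def by (intro mult_left_mono) auto
  finally have Qe: "3 / Q \<le> \<epsilon> / 2" using Q0 by (simp add: field_simps)
  have "\<bar>of_int q * \<alpha> - of_int p\<bar> \<le> 1 / of_int q"
    using pq(5) divide_left_mono[OF pq(4), of 1] n0 pq(2) by simp
  from visits_block_le[OF pq(1,2) this assms(1)]
  have block: "real (visits \<alpha> s l (nat q)) \<le> l * Q + 3" for s unfolding Q_def .
  obtain N0 :: nat where N0: "2 * (l * Q + 3) / \<epsilon> < N0" using reals_Archimedean2 by blast
  have "real (visits \<alpha> s l N) \<le> (l + \<epsilon>) * N" if "N0 \<le> N" for N s
  proof -
    define t where "t = N div nat q + 1"
    have "N \<le> t * nat q"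
      using pq(2) div_mult_mod_eq[of N "nat q"] mod_less_divisor[of "nat q" N]
      unfolding t_def add_mult_distrib by linarith
    then have "real (visits \<alpha> s l N) \<le> real (visits \<alpha> s l (t * nat q))"
      using visits_mono by simp
    also have "\<dots> \<le> t * (l * Q + 3)" using block by (rule visits_blocks_le)
    also have "\<dots> \<le> (N / Q + 1) * (l * Q + 3)"
      using assms(1) Q0 of_nat_div_le_of_nat[of N "nat q", where ?'a = real] unfolding t_def Q
      by (intro mult_right_mono) auto
    also have "\<dots> = l * N + 3 / Q * N + (l * Q + 3)" using Q0 by (simp add: field_simps)
    also have "3 / Q * N \<le> \<epsilon> / 2 * N" using Qe by (intro mult_right_mono) auto
    also have "l * Q + 3 \<le> \<epsilon> / 2 * N"
    proof -
      have "2 * (l * Q + 3) / \<epsilon> < N" using N0 that by (meson less_le_trans of_nat_le_iff)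
      then show ?thesis using assms(2) by (simp add: field_simps)
    qed
    finally show ?thesis by (simp add: algebra_simps)
  qed
  then show ?thesis by blast
qed

lemma visits_lower:
  assumes "0 \<le> l" and "l \<le> 1" and "0 < \<epsilon>"
  shows "\<exists>N0. \<forall>N\<ge>N0::nat. \<forall>s. (l - \<epsilon>) * N \<le> real (visits \<alpha> s l N)"
proof -
  obtain N0 where N0: "\<And>N s. N0 \<le> N \<Longrightarrow> real (visits \<alpha> s (1 - l) N) \<le> (1 - l + \<epsilon>) * N"
    using visits_upper[of "1 - l" \<epsilon>] assms by auto
  have "(l - \<epsilon>) * N \<le> real (visits \<alpha> s l N)" if "N0 \<le> N" for N s
  proof -
    have "real (visits \<alpha> s l N) + real (visits \<alpha> (s + l) (1 - l) N) = N"
      using visits_complement[OF assms(1,2), of \<alpha> s N] by (metis of_nat_add)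
    then show ?thesis using N0[OF that, of "s + l"] by (simp add: algebra_simps)
  qed
  then show ?thesis by blast
qed

end

section \<open>Twisted sums of maximal growth make the cocycle nearly trivial\<close>

text \<open>The accumulated weight of \<open>j\<close> steps, where entering \<open>[0, b)\<close> has weight \<open>\<omega>\<close>. For an \<open>n\<close>-th root of
  unity it records the number of gates passed modulo \<open>n\<close> through one character.\<close>

definition cocycle :: "real \<Rightarrow> real \<Rightarrow> complex \<Rightarrow> nat \<Rightarrow> real \<Rightarrow> complex" where
  "cocycle \<alpha> b \<omega> j x = (\<Prod>i<j. if frac (x + real i * \<alpha>) < b then \<omega> else 1)"

text \<open>Up to a constant factor, a Fourier coefficient with respect to the number of the square of the
  function counting the visits to one arc.\<close>

definition twisted_sum :: "real \<Rightarrow> real \<Rightarrow> complex \<Rightarrow> real \<Rightarrow> real \<Rightarrow> nat \<Rightarrow> real \<Rightarrow> complex" where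
  "twisted_sum \<alpha> b \<omega> s l N x =
     (\<Sum>j<N. cocycle \<alpha> b \<omega> j x * of_bool (frac (x + real j * \<alpha> - s) < l))"

lemma norm_cocycle: "norm \<omega> = 1 \<Longrightarrow> norm (cocycle \<alpha> b \<omega> j x) = 1"
  unfolding cocycle_def by (induction j) (auto simp: norm_mult)

lemma cocycle_add:
  "cocycle \<alpha> b \<omega> (i + j) x = cocycle \<alpha> b \<omega> i x * cocycle \<alpha> b \<omega> j (x + real i * \<alpha>)"
  by (induction j) (simp_all add: cocycle_def algebra_simps)

lemma twisted_sum_add:
  "twisted_sum \<alpha> b \<omega> s l (N + K) x =
     twisted_sum \<alpha> b \<omega> s l N x + cocycle \<alpha> b \<omega> N x * twisted_sum \<alpha> b \<omega> s l K (x + real N * \<alpha>)"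
proof (induction K)
  case (Suc K)
  have "twisted_sum \<alpha> b \<omega> s l (N + Suc K) x = twisted_sum \<alpha> b \<omega> s l (N + K) x +
      cocycle \<alpha> b \<omega> (N + K) x * of_bool (frac (x + real (N + K) * \<alpha> - s) < l)"
    by (simp add: twisted_sum_def)
  moreover have "x + real (N + K) * \<alpha> = x + real N * \<alpha> + real K * \<alpha>"
    by (simp add: algebra_simps)
  ultimately show ?case
    unfolding Suc.IH cocycle_add by (simp add: twisted_sum_def algebra_simps)
qed (simp add: twisted_sum_def)

lemma norm_twisted_sum_le:
  assumes "norm \<omega> = 1"
  shows "norm (twisted_sum \<alpha> b \<omega> s l N x) \<le> N"
proof -
  have "norm (twisted_sum \<alpha> b \<omega> s l N x) \<le> (\<Sum>j<N. 1)"
    unfolding twisted_sum_def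
    by (intro sum_norm_le) (auto simp: norm_mult norm_cocycle[OF assms] of_bool_def)
  then show ?thesis by simp
qed

text \<open>Each of the \<open>K\<close> positions in the window contributes the full sum up to an error at its two ends.\<close>

lemma twisted_sum_windows:
  assumes "norm \<omega> = 1"
  shows "norm ((\<Sum>j<N. cocycle \<alpha> b \<omega> j x * twisted_sum \<alpha> b \<omega> s l K (x + real j * \<alpha>)) -
    of_nat K * twisted_sum \<alpha> b \<omega> s l N x) \<le> 2 * real K ^ 2"
proof -
  define G where "G N = twisted_sum \<alpha> b \<omega> s l N x" for N
  have step: "norm (G (i + j) - G i) \<le> j" for i j
    unfolding G_def twisted_sum_add
    using norm_twisted_sum_le[OF assms] by (simp add: norm_mult norm_cocycle[OF assms])
  have window: "cocycle \<alpha> b \<omega> j x * twisted_sum \<alpha> b \<omega> s l K (x + real j * \<alpha>) = G (j + K) - G j" for j K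
    unfolding G_def twisted_sum_add by simp
  have "norm ((\<Sum>j<N. G (j + K) - G j) - of_nat K * G N) \<le> 2 * real K ^ 2"
  proof (induction K)
    case (Suc K)
    have "(\<Sum>j<N. G (j + Suc K) - G j) - of_nat (Suc K) * G N =
        ((\<Sum>j<N. G (j + K) - G j) - of_nat K * G N) + ((\<Sum>j<N. G (Suc j + K) - G (j + K)) - G N)"
      by (simp add: sum_subtractf algebra_simps)
    also have "(\<Sum>j<N. G (Suc j + K) - G (j + K)) = G (N + K) - G K"
      using sum_lessThan_telescope[of "\<lambda>j. G (j + K)" N] by simp
    finally have "norm ((\<Sum>j<N. G (j + Suc K) - G j) - of_nat (Suc K) * G N) \<le>
        2 * real K ^ 2 + norm (G (N + K) - G K - G N)"
      using Suc.IH by (smt (verit) norm_triangle_ineq)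
    also have "norm (G (N + K) - G K - G N) \<le> norm (G (N + K) - G N) + norm (G K)"
      using norm_triangle_ineq4[of "G (N + K) - G N" "G K"] by (simp add: algebra_simps)
    also have "\<dots> \<le> real K + real K"
      using step[of N K] norm_twisted_sum_le[OF assms] unfolding G_def by (intro add_mono) auto
    finally show ?case by (simp add: power2_eq_square algebra_simps)
  qed simp
  then show ?thesis unfolding window G_def .
qed

text \<open>The inner product of a vector of length at most \<open>M + \<epsilon>\<close> with the direction of the sum is at most
  \<open>M + \<epsilon>\<close>. If the average has length almost \<open>M\<close>, then most of these inner products are almost
  maximal, which leaves little room for the vectors to deviate from one common vector.\<close>

lemma nearly_extremal_average:
  fixes u :: "nat \<Rightarrow> complex"
  assumes "0 \<le> M" and "M \<le> 1" and "0 \<le> \<epsilon>" and "\<epsilon> \<le> 1"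
    and le: "\<And>j. j < N \<Longrightarrow> norm (u j) \<le> M + \<epsilon>"
    and ge: "(M - 2 * \<epsilon>) * N \<le> norm (\<Sum>j<N. u j)"
  obtains d where "norm d = M" and "(\<Sum>j<N. norm (u j - d) ^ 2) \<le> 7 * \<epsilon> * N"
proof -
  define S where "S = (\<Sum>j<N. u j)"
  define e :: complex where "e = (if S = 0 then 1 else sgn S)"
  have e: "norm e = 1" "S \<bullet> e = norm S"
    unfolding e_def by (auto simp: norm_sgn sgn_div_norm power2_norm_eq_inner[symmetric] power2_eq_square)
  have "(\<Sum>j<N. norm (u j - M *\<^sub>R e) ^ 2) = (\<Sum>j<N. norm (u j) ^ 2 + M\<^sup>2 - 2 * M * (u j \<bullet> e))"
  proof (rule sum.cong[OF refl])
    fix j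
    have "norm (u j - M *\<^sub>R e) ^ 2 = norm (u j) ^ 2 - 2 * (u j \<bullet> (M *\<^sub>R e)) + norm (M *\<^sub>R e) ^ 2"
      unfolding power2_norm_eq_inner by (simp add: inner_diff_left inner_diff_right inner_commute)
    then show "norm (u j - M *\<^sub>R e) ^ 2 = norm (u j) ^ 2 + M\<^sup>2 - 2 * M * (u j \<bullet> e)"
      using e(1) by (simp add: power_mult_distrib)
  qed
  also have "\<dots> = (\<Sum>j<N. norm (u j) ^ 2 + M\<^sup>2) - 2 * M * (S \<bullet> e)"
    unfolding S_def inner_sum_left by (simp add: sum_subtractf sum_distrib_left)
  also have "\<dots> \<le> (\<Sum>j<N. (M + \<epsilon>)\<^sup>2 + M\<^sup>2) - 2 * M * ((M - 2 * \<epsilon>) * N)"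
    using ge assms(1) le unfolding e(2) S_def[symmetric]
    by (intro diff_mono sum_mono add_mono power_mono mult_left_mono) auto
  also have "\<dots> = (6 * (M * \<epsilon>) + \<epsilon> * \<epsilon>) * N"
    by (simp add: power2_eq_square algebra_simps)
  also have "\<dots> \<le> (6 * (1 * \<epsilon>) + 1 * \<epsilon>) * N"
    using assms by (intro mult_right_mono add_mono mult_left_mono) auto
  finally have "(\<Sum>j<N. norm (u j - M *\<^sub>R e) ^ 2) \<le> 7 * \<epsilon> * N" by simp
  moreover have "norm (M *\<^sub>R e) = M" using e(1) assms(1) by simp
  ultimately show thesis using that by blast
qed

lemma markov_card:
  fixes f :: "nat \<Rightarrow> real"
  assumes "0 < t" and "\<And>j. 0 \<le> f j" and "(\<Sum>j<N. f j) \<le> B"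
  shows "t * card {j. j < N \<and> t \<le> f j} \<le> B"
proof -
  have "t * card {j. j < N \<and> t \<le> f j} = (\<Sum>j | j < N \<and> t \<le> f j. t)" by simp
  also have "\<dots> \<le> (\<Sum>j | j < N \<and> t \<le> f j. f j)" by (intro sum_mono) auto
  also have "\<dots> \<le> (\<Sum>j<N. f j)" using assms(2) by (intro sum_mono2) auto
  finally show ?thesis using assms(3) by linarith
qed

lemma frac_add_of_int: "frac (x + of_int k) = frac x"
  by (simp add: frac_def)

lemma frac_near_int_less:
  fixes z \<eta> :: real and k :: int
  assumes "\<bar>z - of_int k\<bar> \<le> \<eta>" and "0 < \<eta>"
  shows "frac (z + \<eta>) < 3 * \<eta>"
proof -
  have "frac (z + \<eta>) = frac (of_int k + (z - of_int k + \<eta>))" by simp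
  also have "\<dots> \<le> frac (of_int k :: real) + (z - of_int k + \<eta>)"
    using assms by (intro frac_add_nonneg_le) auto
  finally show ?thesis using assms by simp
qed

text \<open>A window of fixed length is a step function, so it changes under a small rotation only near
  its finitely many discontinuities.\<close>

lemma twisted_sum_perturb:
  fixes p :: int
  assumes b: "0 \<le> b" "b \<le> 1" and l: "0 \<le> l" "l \<le> 1" and \<eta>: "\<bar>real q * \<alpha> - of_int p\<bar> \<le> \<eta>" "0 < \<eta>"
    and neq: "twisted_sum \<alpha> b \<omega> s l K (x + real q * \<alpha>) \<noteq> twisted_sum \<alpha> b \<omega> s l K x"
  shows "\<exists>i<K. \<exists>t\<in>{0, b, s, s + l}. frac (x + real i * \<alpha> - t + \<eta>) < 3 * \<eta>"
proof (rule ccontr)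
  assume "\<not> ?thesis"
  then have far: "\<not> frac (x + real i * \<alpha> - t + \<eta>) < 3 * \<eta>" if "i < K" "t \<in> {0, b, s, s + l}" for i t
    using that by blast
  have away: "\<eta> < \<bar>x + real i * \<alpha> - t - of_int k\<bar>" if "i < K" "t \<in> {0, b, s, s + l}" for i t k
    using far[OF that] frac_near_int_less[OF _ \<eta>(2)] by (meson not_less)
  define e where "e = real q * \<alpha> - of_int p"
  have e: "\<bar>e\<bar> \<le> \<eta>" using \<eta>(1) unfolding e_def .
  have shift: "frac (z + real q * \<alpha>) = frac (z + e)" for z
    using frac_add_of_int[of "z + e" p] unfolding e_def by (simp add: algebra_simps)
  have 1: "frac (x + real q * \<alpha> + real i * \<alpha>) < b \<longleftrightarrow> frac (x + real i * \<alpha>) < b" if "i < K" for i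
    using frac_less_perturb[OF b e, of "x + real i * \<alpha>"] away[OF that, of 0] away[OF that, of b]
      shift[of "x + real i * \<alpha>"] by (simp add: add_ac)
  have 2: "frac (x + real q * \<alpha> + real i * \<alpha> - s) < l \<longleftrightarrow> frac (x + real i * \<alpha> - s) < l" if "i < K" for i
    using frac_less_perturb[OF l e, of "x + real i * \<alpha> - s"] away[OF that, of s] away[OF that, of "s + l"]
      shift[of "x + real i * \<alpha> - s"] by (simp add: algebra_simps)
  have "cocycle \<alpha> b \<omega> j (x + real q * \<alpha>) = cocycle \<alpha> b \<omega> j x" if "j < K" for j
    unfolding cocycle_def using 1 that by (intro prod.cong) auto
  then have "twisted_sum \<alpha> b \<omega> s l K (x + real q * \<alpha>) = twisted_sum \<alpha> b \<omega> s l K x"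
    unfolding twisted_sum_def using 2 by (intro sum.cong) auto
  then show False using neq by contradiction
qed

context badly_approximable_rotation
begin

text \<open>A change of the window forces the point to be \<open>\<eta>\<close>-close to one of at most \<open>4 K\<close> points, and the
  arc around each of them has length \<open>3 \<eta>\<close>.\<close>

lemma card_window_changes_le:
  assumes b: "0 \<le> b" "b \<le> 1" and l: "0 \<le> l" "l \<le> 1" and "0 < \<eta>"
  shows "\<exists>N0. \<forall>N\<ge>N0::nat. \<forall>x q. \<forall>p :: int. \<bar>real q * \<alpha> - of_int p\<bar> \<le> \<eta> \<longrightarrow>
    real (card {j. j < N \<and> twisted_sum \<alpha> b \<omega> s l K (x + real j * \<alpha> + real q * \<alpha>) \<noteq>
      twisted_sum \<alpha> b \<omega> s l K (x + real j * \<alpha>)}) \<le> 16 * \<eta> * K * N"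
proof -
  obtain N0 where N0: "\<And>N s. N0 \<le> N \<Longrightarrow> real (visits \<alpha> s (3 * \<eta>) N) \<le> (3 * \<eta> + \<eta>) * N"
    using visits_upper[of "3 * \<eta>" \<eta>] \<open>0 < \<eta>\<close> by auto
  have "real (card {j. j < N \<and> twisted_sum \<alpha> b \<omega> s l K (x + real j * \<alpha> + real q * \<alpha>) \<noteq>
      twisted_sum \<alpha> b \<omega> s l K (x + real j * \<alpha>)}) \<le> 16 * \<eta> * K * N" (is "real (card ?E) \<le> _")
    if N: "N0 \<le> N" and q: "\<bar>real q * \<alpha> - of_int p\<bar> \<le> \<eta>" for N x q and p :: int
  proof -
    define T where "T = {0, b, s, s + l}"
    define H where "H = (\<lambda>(i, t). {j. j < N \<and> frac (real j * \<alpha> - (t - \<eta> - x - real i * \<alpha>)) < 3 * \<eta>})"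
    have "card T \<le> 4" unfolding T_def using card_insert_le_m1 by (auto simp: card_insert_if)
    have "?E \<subseteq> (\<Union>z\<in>{..<K} \<times> T. H z)"
    proof
      fix j assume j: "j \<in> ?E"
      then have neq: "twisted_sum \<alpha> b \<omega> s l K (x + real j * \<alpha> + real q * \<alpha>) \<noteq>
        twisted_sum \<alpha> b \<omega> s l K (x + real j * \<alpha>)" by simp
      obtain i t where "i < K" "t \<in> T" "frac (x + real j * \<alpha> + real i * \<alpha> - t + \<eta>) < 3 * \<eta>"
        using twisted_sum_perturb[OF b l q \<open>0 < \<eta>\<close> neq] unfolding T_def by (elim exE conjE bexE)
      moreover have "x + real j * \<alpha> + real i * \<alpha> - t + \<eta> = real j * \<alpha> - (t - \<eta> - x - real i * \<alpha>)" by simp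
      ultimately have "j \<in> H (i, t)" using j unfolding H_def by auto
      then show "j \<in> (\<Union>z\<in>{..<K} \<times> T. H z)" using \<open>i < K\<close> \<open>t \<in> T\<close> by blast
    qed
    then have "card ?E \<le> card (\<Union>z\<in>{..<K} \<times> T. H z)"
      by (intro card_mono) (auto simp: H_def T_def)
    also have "\<dots> \<le> (\<Sum>z\<in>{..<K} \<times> T. card (H z))"
      by (rule card_UN_le) (auto simp: T_def)
    finally have "real (card ?E) \<le> (\<Sum>z\<in>{..<K} \<times> T. real (card (H z)))"
      unfolding of_nat_sum[symmetric] of_nat_le_iff .
    also have "\<dots> \<le> (\<Sum>z\<in>{..<K} \<times> T. (3 * \<eta> + \<eta>) * N)"
      using N0[OF N] unfolding H_def visits_def by (intro sum_mono) (simp split: prod.split)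
    also have "\<dots> = real K * real (card T) * (4 * \<eta> * N)" by (simp add: card_cartesian_product)
    also have "\<dots> \<le> real K * 4 * (4 * \<eta> * N)"
      using \<open>card T \<le> 4\<close> \<open>0 < \<eta>\<close> by (intro mult_right_mono mult_left_mono) auto
    finally show ?thesis by (simp add: algebra_simps)
  qed
  then show ?thesis by blast
qed

text \<open>If the twisted sums grow at the linear rate \<open>M > 0\<close>, then a window of a suitable fixed length \<open>K\<close>,
  divided by \<open>K\<close>, acts as an approximate transfer function. Along an orbit on which a much longer sum
  is nearly extremal, the products of the cocycle with the windows have almost maximal average and
  hence are almost constant. If \<open>q \<alpha>\<close> is nearly an integer, the window itself rarely changes over \<open>q\<close>
  steps, so that the cocycle over \<open>q\<close> steps is close to 1 at most points of that orbit.\<close>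

lemma cocycle_nearly_trivial:
  assumes \<omega>: "norm \<omega> = 1" and b: "0 \<le> b" "b \<le> 1" and l: "0 \<le> l" "l \<le> 1"
    and M: "0 < M" "M \<le> 1" and \<tau>: "0 < \<tau>" and \<delta>: "0 < \<delta>"
    and upper: "\<And>\<epsilon>. 0 < \<epsilon> \<Longrightarrow> \<exists>K>0. \<forall>x. norm (twisted_sum \<alpha> b \<omega> s l K x) \<le> (M + \<epsilon>) * K"
    and lower: "\<And>r N. r < M \<Longrightarrow> 0 < N \<Longrightarrow> \<exists>x. r * N < norm (twisted_sum \<alpha> b \<omega> s l N x)"
  shows "\<exists>\<eta>>0. \<forall>q. \<forall>p :: int. \<bar>real q * \<alpha> - of_int p\<bar> \<le> \<eta> \<longrightarrow>
    (\<exists>N0. \<forall>N\<ge>N0::nat. \<exists>x. real (card {j. j < N \<and> \<tau> \<le> norm (1 - cocycle \<alpha> b \<omega> q (x + real j * \<alpha>))}) \<le> \<delta> * N)"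
proof -
  define t where "t = \<tau> * M / 2"
  have t0: "0 < t" unfolding t_def using \<tau> M by simp
  define \<epsilon> where "\<epsilon> = min 1 (\<delta> * t\<^sup>2 / 56)"
  have \<epsilon>: "0 < \<epsilon>" "\<epsilon> \<le> 1" "56 * \<epsilon> \<le> \<delta> * t\<^sup>2" unfolding \<epsilon>_def using \<delta> t0 by auto
  obtain K where K0: "0 < K" and K: "\<And>x. norm (twisted_sum \<alpha> b \<omega> s l K x) \<le> (M + \<epsilon>) * K"
    using upper[OF \<epsilon>(1)] by blast
  define \<eta> where "\<eta> = \<delta> / (32 * K)"
  have \<eta>0: "0 < \<eta>" unfolding \<eta>_def using \<delta> K0 by simp
  obtain N1 where N1: "\<And>N x q p. N1 \<le> N \<Longrightarrow> \<bar>real q * \<alpha> - of_int p\<bar> \<le> \<eta> \<Longrightarrow>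
    real (card {j. j < N \<and> twisted_sum \<alpha> b \<omega> s l K (x + real j * \<alpha> + real q * \<alpha>) \<noteq>
      twisted_sum \<alpha> b \<omega> s l K (x + real j * \<alpha>)}) \<le> 16 * \<eta> * K * N"
    using card_window_changes_le[OF b l \<eta>0, of \<omega> s K] by meson
  obtain N2 :: nat where N2: "2 * K / \<epsilon> < N2" using reals_Archimedean2 by blast
  have "\<exists>x. real (card {j. j < N \<and> \<tau> \<le> norm (1 - cocycle \<alpha> b \<omega> q (x + real j * \<alpha>))}) \<le> \<delta> * N"
    if q: "\<bar>real q * \<alpha> - of_int p\<bar> \<le> \<eta>" and N: "N1 \<le> N" "N2 \<le> N" "q < N" for q N and p :: int
  proof -
    \<comment> \<open>The comparison of \<open>j\<close> with \<open>j + q\<close> for \<open>j < N\<close> takes place inside a sum of this length.\<close>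
    define N' where "N' = N + q"
    have N': "0 < N'" "real N' \<le> 2 * N" "2 * K / \<epsilon> < N'" using N N2 unfolding N'_def by auto
    obtain x where x: "(M - \<epsilon>) * N' < norm (twisted_sum \<alpha> b \<omega> s l N' x)"
      using lower[of "M - \<epsilon>" N'] \<epsilon>(1) N'(1) by auto
    define u where "u j = cocycle \<alpha> b \<omega> j x * twisted_sum \<alpha> b \<omega> s l K (x + real j * \<alpha>) / of_nat K" for j
    have u_le: "norm (u j) \<le> M + \<epsilon>" for j
      using K[of "x + real j * \<alpha>"] K0
      unfolding u_def by (simp add: norm_mult norm_divide norm_cocycle[OF \<omega>] pos_divide_le_eq)
    have "(M - 2 * \<epsilon>) * N' \<le> norm (\<Sum>j<N'. u j)"
    proof -
      define G where "G = twisted_sum \<alpha> b \<omega> s l N' x"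
      have "of_nat K * (\<Sum>j<N'. u j) =
          (\<Sum>j<N'. cocycle \<alpha> b \<omega> j x * twisted_sum \<alpha> b \<omega> s l K (x + real j * \<alpha>))"
        unfolding u_def sum_distrib_left using K0 by (intro sum.cong) auto
      then have "norm (of_nat K * (\<Sum>j<N'. u j) - of_nat K * G) \<le> 2 * real K ^ 2"
        using twisted_sum_windows[OF \<omega>, where N = N' and x = x and K = K] unfolding G_def by simp
      then have "K * norm ((\<Sum>j<N'. u j) - G) \<le> K * (2 * K)"
        unfolding right_diff_distrib[symmetric] by (simp add: norm_mult power2_eq_square)
      then have "norm ((\<Sum>j<N'. u j) - G) \<le> 2 * K" using K0 by simp
      moreover have "norm G - norm ((\<Sum>j<N'. u j) - G) \<le> norm (\<Sum>j<N'. u j)"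
        using norm_triangle_ineq2[of G "G - (\<Sum>j<N'. u j)"] by (simp add: norm_minus_commute)
      moreover have "2 * K \<le> \<epsilon> * N'" using N'(3) \<epsilon>(1) by (simp add: field_simps)
      ultimately show ?thesis using x unfolding G_def by (simp add: algebra_simps)
    qed
    then obtain d where d: "norm d = M" and d_sum: "(\<Sum>j<N'. norm (u j - d) ^ 2) \<le> 7 * \<epsilon> * N'"
      using nearly_extremal_average[where N = N' and u = u and M = M and \<epsilon> = \<epsilon>] u_le M \<epsilon> by auto
    \<comment> \<open>The exceptional indices: those where the product is far from \<open>d\<close>, and those where the window changes.\<close>
    define F where "F = {j. j < N' \<and> t\<^sup>2 \<le> norm (u j - d) ^ 2}"
    have "t\<^sup>2 * card F \<le> 7 * \<epsilon> * N'"
      unfolding F_def using d_sum t0 by (intro markov_card) auto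
    also have "\<dots> \<le> 7 * \<epsilon> * (2 * N)" using N'(2) \<epsilon>(1) by (intro mult_left_mono) auto
    also have "\<dots> \<le> \<delta> * t\<^sup>2 / 4 * N" using mult_right_mono[OF \<epsilon>(3), of "real N"] by (simp add: mult_ac)
    finally have "t\<^sup>2 * card F \<le> t\<^sup>2 * (\<delta> / 4 * N)" by (simp add: mult_ac)
    then have F: "real (card F) \<le> \<delta> / 4 * N" using t0 by simp
    define E where "E = {j. j < N \<and> twisted_sum \<alpha> b \<omega> s l K (x + real j * \<alpha> + real q * \<alpha>) \<noteq>
      twisted_sum \<alpha> b \<omega> s l K (x + real j * \<alpha>)}"
    have "real (card E) \<le> 16 * \<eta> * K * N" unfolding E_def using N1[OF N(1) q] .
    also have "\<dots> = \<delta> / 2 * N" unfolding \<eta>_def using K0 by simp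
    finally have E: "real (card E) \<le> \<delta> / 2 * N" .
    define D where "D = {j. j < N \<and> \<tau> \<le> norm (1 - cocycle \<alpha> b \<omega> q (x + real j * \<alpha>))}"
    have "D \<subseteq> F \<union> {j. j + q \<in> F} \<union> E"
    proof
      fix j assume j: "j \<in> D"
      define z where "z = cocycle \<alpha> b \<omega> q (x + real j * \<alpha>)"
      show "j \<in> F \<union> {j. j + q \<in> F} \<union> E"
      proof (rule ccontr)
        assume *: "j \<notin> F \<union> {j. j + q \<in> F} \<union> E"
        then have "u (j + q) = z * u j"
          using j unfolding u_def z_def D_def E_def cocycle_add by (simp add: algebra_simps)
        then have "(z - 1) * d = z * (d - u j) + (u (j + q) - d)" by (simp add: algebra_simps)
        then have "norm ((z - 1) * d) \<le> norm (z * (d - u j)) + norm (u (j + q) - d)"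
          using norm_triangle_ineq by metis
        then have "norm (1 - z) * M \<le> norm (u j - d) + norm (u (j + q) - d)"
          unfolding norm_mult d using norm_cocycle[OF \<omega>] unfolding z_def
          by (simp add: norm_minus_commute)
        also have "norm (u i - d) < t" if "i < N'" "i \<notin> F" for i
          using that t0 unfolding F_def by (auto intro: power2_less_imp_less)
        then have "norm (u j - d) + norm (u (j + q) - d) < t + t"
          using * j unfolding D_def N'_def by (intro add_strict_mono) auto
        finally have "norm (1 - z) * M < \<tau> * M" unfolding t_def by (simp add: mult.commute)
        then show False using j M unfolding D_def z_def by simp
      qed
    qed
    then have "card D \<le> card (F \<union> {j. j + q \<in> F} \<union> E)"
    proof (rule card_mono[rotated])
      have "finite ((\<lambda>j. j + q) -` F)" by (rule finite_vimageI) (auto simp: F_def inj_on_def)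
      then show "finite (F \<union> {j. j + q \<in> F} \<union> E)" unfolding vimage_def by (auto simp: F_def E_def)
    qed
    also have "\<dots> \<le> card F + card {j. j + q \<in> F} + card E"
      by (meson add_le_mono card_Un_le le_refl order_trans)
    also have "card {j. j + q \<in> F} \<le> card F"
      by (rule card_inj_on_le[where f = "\<lambda>j. j + q"]) (auto simp: inj_on_def F_def)
    finally have "real (card D) \<le> \<delta> * N" using F E by simp
    then show ?thesis unfolding D_def by blast
  qed
  then have "\<exists>N0. \<forall>N\<ge>N0::nat. \<exists>x. real (card {j. j < N \<and> \<tau> \<le> norm (1 - cocycle \<alpha> b \<omega> q (x + real j * \<alpha>))}) \<le> \<delta> * N"
    if "\<bar>real q * \<alpha> - of_int p\<bar> \<le> \<eta>" for q and p :: int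
    using that by (intro exI[of _ "N1 + N2 + Suc q"]) auto
  then show ?thesis using \<eta>0 by blast
qed

end

section \<open>Discontinuities of the cocycle\<close>

context badly_approximable_rotation
begin

text \<open>Between the arcs on the two sides of \<open>- i \<alpha>\<close> only the factor with index \<open>i\<close> changes, because every other
  discontinuity of the product is more than \<open>d\<close> away from \<open>- i \<alpha>\<close>.\<close>

lemma cocycle_jump:
  fixes q :: nat
  assumes "i < q" and d: "0 < d" "d \<le> b" "d \<le> 1 - b" "d < c / q"
    and isolated: "\<And>i' k. i' < q \<Longrightarrow> d < \<bar>(real i' - real i) * \<alpha> - b - of_int k\<bar>"
    and right: "frac (y + real i * \<alpha>) < d" and left: "frac (y' + real i * \<alpha> + d) < d"
  shows "cocycle \<alpha> b \<omega> q y = \<omega> * cocycle \<alpha> b \<omega> q y'"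
proof -
  define k where "k = \<lfloor>y + real i * \<alpha>\<rfloor>"
  define k' where "k' = \<lfloor>y' + real i * \<alpha> + d\<rfloor>"
  define e where "e = frac (y + real i * \<alpha>)"
  define e' where "e' = frac (y' + real i * \<alpha> + d) - d"
  have y: "y = of_int k + e - real i * \<alpha>" unfolding k_def e_def frac_def by simp
  have y': "y' = of_int k' + e' - real i * \<alpha>" unfolding k'_def e'_def frac_def by simp
  have e: "0 \<le> e" "e < d" using right unfolding e_def by auto
  have e': "- d \<le> e'" "e' < 0" using left unfolding e'_def by auto
  have factor: "(if frac (y + real j * \<alpha>) < b then \<omega> else 1) =
      (if j = i then \<omega> else 1) * (if frac (y' + real j * \<alpha>) < b then \<omega> else 1)" if "j < q" for j
  proof (cases "j = i")
    case True
    have "y' + real i * \<alpha> = e' + of_int k'" unfolding y' by simp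
    then have "frac (y' + real i * \<alpha>) = frac e'" by (simp add: frac_add_of_int)
    also have "frac e' = e' + 1" unfolding frac_unique_iff using e' d by auto
    finally show ?thesis using True right e' d by simp
  next
    case False
    define z where "z = (real j - real i) * \<alpha>"
    have "frac (z + f) < b \<longleftrightarrow> frac z < b" if "\<bar>f\<bar> \<le> d" for f
    proof (rule frac_less_perturb)
      show "d < \<bar>z - of_int m\<bar>" for m
      proof -
        have "c / q \<le> \<bar>of_int (int j - int i) * \<alpha> - of_int m\<bar>"
          using False \<open>i < q\<close> \<open>j < q\<close> by (intro separation_le) auto
        then show ?thesis using d unfolding z_def by simp
      qed
      show "d < \<bar>z - b - of_int m\<bar>" for m using isolated[OF \<open>j < q\<close>] unfolding z_def .
    qed (use d that in auto)
    moreover have "frac (y + real j * \<alpha>) = frac (z + e)" "frac (y' + real j * \<alpha>) = frac (z + e')"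
      using frac_add_of_int[of "z + e" k] frac_add_of_int[of "z + e'" k']
      unfolding y y' z_def by (simp_all add: algebra_simps)
    ultimately show ?thesis using False e e' by simp
  qed
  have "cocycle \<alpha> b \<omega> q y = (\<Prod>j<q. (if j = i then \<omega> else 1) *
      (if frac (y' + real j * \<alpha>) < b then \<omega> else 1))"
    unfolding cocycle_def using factor by (intro prod.cong) auto
  also have "\<dots> = \<omega> * cocycle \<alpha> b \<omega> q y'"
    using \<open>i < q\<close> unfolding prod.distrib cocycle_def by (simp add: prod.delta)
  finally show ?thesis .
qed

text \<open>An uncompensated jump by the factor \<open>\<omega> \<noteq> 1\<close> keeps the cocycle away from 1 on one of the two adjacent
  arcs of length \<open>d\<close>. These arcs are disjoint for different jumps because the points \<open>- i \<alpha>\<close> are separated,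
  and an orbit spends in each of them at least the proportion \<open>d / 2\<close> of its time.\<close>

lemma isolated_discontinuities_le:
  fixes q :: nat and \<delta> :: real
  assumes \<omega>: "norm \<omega> = 1" and q: "0 < q" and d: "0 < d" "d \<le> b" "d \<le> 1 - b" "2 * d < c / q"
    and trivial: "\<exists>N0. \<forall>N\<ge>N0::nat. \<exists>x. real (card {j. j < N \<and>
      norm (1 - \<omega>) / 2 \<le> norm (1 - cocycle \<alpha> b \<omega> q (x + real j * \<alpha>))}) \<le> \<delta> * N"
  shows "d / 2 * card {i. i < q \<and> (\<forall>i'<q. \<forall>k :: int. d < \<bar>(real i' - real i) * \<alpha> - b - of_int k\<bar>)} \<le> \<delta>"
proof -
  define U where "U = {i. i < q \<and> (\<forall>i'<q. \<forall>k :: int. d < \<bar>(real i' - real i) * \<alpha> - b - of_int k\<bar>)}"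
  define \<tau> where "\<tau> = norm (1 - \<omega>) / 2"
  define bad where "bad y \<longleftrightarrow> \<tau> \<le> norm (1 - cocycle \<alpha> b \<omega> q y)" for y
  \<comment> \<open>The arc of length \<open>d\<close> starting at \<open>s i\<close> is one of the two arcs ending at \<open>- i \<alpha>\<close>.\<close>
  have "\<exists>s. (s = - real i * \<alpha> \<or> s = - real i * \<alpha> - d) \<and> (\<forall>y. frac (y - s) < d \<longrightarrow> bad y)" if "i \<in> U" for i
  proof (rule ccontr)
    assume "\<not> ?thesis"
    then obtain y y' where y: "frac (y - (- real i * \<alpha>)) < d" "\<not> bad y"
      and y': "frac (y' - (- real i * \<alpha> - d)) < d" "\<not> bad y'" by blast
    have dc: "d < c / q" using d by linarith
    have right: "frac (y + real i * \<alpha>) < d" using y(1) by simp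
    have "y' - (- real i * \<alpha> - d) = y' + real i * \<alpha> + d" by simp
    then have left: "frac (y' + real i * \<alpha> + d) < d" using y'(1) by metis
    have jump: "cocycle \<alpha> b \<omega> q y = \<omega> * cocycle \<alpha> b \<omega> q y'"
      using cocycle_jump[OF _ d(1-3) dc _ right left] that unfolding U_def by simp
    have eq: "1 - \<omega> = (1 - cocycle \<alpha> b \<omega> q y) - \<omega> * (1 - cocycle \<alpha> b \<omega> q y')"
      unfolding jump by (simp add: algebra_simps)
    have "norm (1 - \<omega>) \<le> norm (1 - cocycle \<alpha> b \<omega> q y) + norm (\<omega> * (1 - cocycle \<alpha> b \<omega> q y'))"
      unfolding eq by (rule norm_triangle_ineq4)
    then have "norm (1 - \<omega>) \<le> norm (1 - cocycle \<alpha> b \<omega> q y) + norm (1 - cocycle \<alpha> b \<omega> q y')"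
      unfolding norm_mult \<omega> by simp
    then show False using y(2) y'(2) unfolding bad_def \<tau>_def by simp
  qed
  then obtain s where s: "\<And>i. i \<in> U \<Longrightarrow> s i = - real i * \<alpha> \<or> s i = - real i * \<alpha> - d"
    and bad_arc: "\<And>i y. i \<in> U \<Longrightarrow> frac (y - s i) < d \<Longrightarrow> bad y" by metis
  have near: "- d \<le> s i + real i * \<alpha> \<and> s i + real i * \<alpha> \<le> 0" if "i \<in> U" for i
    using s[OF that] d(1) by auto
  have disjoint: "\<not> (frac (y - s i) < d \<and> frac (y - s j) < d)" if "i \<in> U" "j \<in> U" "i \<noteq> j" for i j y
  proof
    assume *: "frac (y - s i) < d \<and> frac (y - s j) < d"
    define k where "k = \<lfloor>y - s i\<rfloor> - \<lfloor>y - s j\<rfloor>"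
    have "c / q \<le> \<bar>of_int (int i - int j) * \<alpha> - of_int k\<bar>"
      using that unfolding U_def by (intro separation_le) auto
    also have "of_int (int i - int j) * \<alpha> - of_int k =
        (frac (y - s i) - frac (y - s j)) + (s i + real i * \<alpha>) - (s j + real j * \<alpha>)"
      unfolding k_def frac_def by (simp add: algebra_simps)
    also have "\<bar>\<dots>\<bar> \<le> 2 * d"
      using * near[OF that(1)] near[OF that(2)] frac_ge_0[of "y - s i"] frac_ge_0[of "y - s j"] by linarith
    finally show False using d(4) by simp
  qed
  have "\<exists>N0. \<forall>N\<ge>N0::nat. \<forall>s. (d - d / 2) * N \<le> real (visits \<alpha> s d N)"
    using d by (intro visits_lower) auto
  then obtain N1 where N1: "\<And>N s. N1 \<le> N \<Longrightarrow> d / 2 * N \<le> real (visits \<alpha> s d N)" by auto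
  obtain N2 where N2: "\<And>N. N2 \<le> N \<Longrightarrow> \<exists>x. real (card {j. j < N \<and> bad (x + real j * \<alpha>)}) \<le> \<delta> * N"
    using trivial unfolding bad_def \<tau>_def by blast
  define N where "N = N1 + N2 + 1"
  obtain x where x: "real (card {j. j < N \<and> bad (x + real j * \<alpha>)}) \<le> \<delta> * N"
    using N2[of N] unfolding N_def by auto
  define H where "H i = {j. j < N \<and> frac (real j * \<alpha> - (s i - x)) < d}" for i
  have H_eq: "j \<in> H i \<longleftrightarrow> j < N \<and> frac (x + real j * \<alpha> - s i) < d" for i j
    unfolding H_def by (simp add: algebra_simps)
  have "finite U" unfolding U_def by simp
  have "d / 2 * N * card U = (\<Sum>i\<in>U. d / 2 * N)" by simp
  also have "\<dots> \<le> (\<Sum>i\<in>U. real (card (H i)))"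
    using N1[of N] unfolding H_def visits_def N_def by (intro sum_mono) auto
  also have "\<dots> = card (\<Union>i\<in>U. H i)"
  proof (subst card_UN_disjoint)
    show "\<forall>i\<in>U. \<forall>j\<in>U. i \<noteq> j \<longrightarrow> H i \<inter> H j = {}"
      using disjoint H_eq by blast
  qed (use \<open>finite U\<close> in \<open>auto simp: H_def\<close>)
  also have "\<dots> \<le> card {j. j < N \<and> bad (x + real j * \<alpha>)}"
    unfolding of_nat_le_iff using bad_arc H_eq by (intro card_mono) auto
  also note x
  finally have "N * (d / 2 * card U) \<le> N * \<delta>" by (simp add: mult_ac)
  then show ?thesis unfolding U_def[symmetric] N_def by (subst (asm) mult_le_cancel_left_pos) auto
qed

text \<open>Two differences \<open>i' - i\<close> are smaller than \<open>2 q\<close> apart and their multiples of \<open>\<alpha>\<close> agree up to \<open>2 d\<close>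
  modulo 1, so by the separation they are equal to one integer \<open>m\<close>. Translation by \<open>m\<close> maps all but
  \<open>\<epsilon> q\<close> of the indices below \<open>q\<close> to such indices, which bounds \<open>m\<close>.\<close>

lemma small_shift:
  fixes q :: nat and \<epsilon> :: real
  assumes q: "0 < q" and d: "0 < d" "2 * d < c / (2 * q)"
    and few: "card {i. i < q \<and> (\<forall>i'<q. \<forall>k :: int. d < \<bar>(real i' - real i) * \<alpha> - b - of_int k\<bar>)} \<le> \<epsilon> * q"
    and "\<epsilon> < 1"
  obtains m k :: int where "\<bar>of_int m\<bar> \<le> \<epsilon> * q" and "\<bar>of_int m * \<alpha> - b - of_int k\<bar> \<le> d"
proof -
  define U where "U = {i. i < q \<and> (\<forall>i'<q. \<forall>k :: int. d < \<bar>(real i' - real i) * \<alpha> - b - of_int k\<bar>)}"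
  define V where "V = {..<q} - U"
  have "card V = q - card U" unfolding V_def by (subst card_Diff_subset) (auto simp: U_def)
  moreover have "card U \<le> q" using card_mono[of "{..<q}" U] unfolding U_def by auto
  ultimately have V_card: "real (card V) = q - card U" by simp
  have few': "real (card U) \<le> \<epsilon> * q" using few unfolding U_def .
  also have "\<dots> < q" using \<open>\<epsilon> < 1\<close> q by simp
  finally have "V \<noteq> {}" using V_card by auto
  then obtain i0 where i0: "i0 \<in> V" by blast
  have partner: "\<exists>i' k. i' < q \<and> \<bar>of_int (int i' - int i) * \<alpha> - b - of_int k\<bar> \<le> d" if "i \<in> V" for i
    using that unfolding V_def U_def by (auto simp: not_less)
  obtain i0' k0 where i0': "i0' < q" and k0: "\<bar>of_int (int i0' - int i0) * \<alpha> - b - of_int k0\<bar> \<le> d"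
    using partner[OF i0] by blast
  define m where "m = int i0' - int i0"
  have shift: "0 \<le> int i + m \<and> int i + m < q" if i: "i \<in> V" for i
  proof -
    obtain i' k where i': "i' < q" and k: "\<bar>of_int (int i' - int i) * \<alpha> - b - of_int k\<bar> \<le> d"
      using partner[OF i] by blast
    have "int i' - int i = m"
    proof (rule ccontr)
      assume neq: "int i' - int i \<noteq> m"
      have "c / (2 * q) \<le> \<bar>of_int (int i' - int i - m) * \<alpha> - of_int (k - k0)\<bar>"
        using neq i0 i' i0' i unfolding m_def V_def by (intro separation_le) auto
      also have "of_int (int i' - int i - m) * \<alpha> - of_int (k - k0) =
          (of_int (int i' - int i) * \<alpha> - b - of_int k) - (of_int m * \<alpha> - b - of_int k0)"
        by (simp add: algebra_simps)
      also have "\<bar>\<dots>\<bar> \<le> d + d" using k k0 unfolding m_def by linarith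
      finally show False using d(2) by simp
    qed
    then show ?thesis using i' by auto
  qed
  have "card V \<le> q - nat \<bar>m\<bar>"
  proof (cases "0 \<le> m")
    case True
    then have "V \<subseteq> {..<q - nat m}" using shift by fastforce
    then have "card V \<le> card {..<q - nat m}" by (intro card_mono) auto
    then show ?thesis using True by simp
  next
    case False
    then have "V \<subseteq> {nat (- m)..<q}" using shift unfolding V_def by fastforce
    then have "card V \<le> card {nat (- m)..<q}" by (intro card_mono) auto
    then show ?thesis using False by simp
  qed
  moreover have "nat \<bar>m\<bar> \<le> q" using i0 i0' unfolding m_def V_def by auto
  ultimately have "real (card V) \<le> real q - of_int \<bar>m\<bar>" by linarith
  then have "\<bar>of_int m\<bar> \<le> \<epsilon> * q" using V_card few' by simp
  then show thesis using that k0 unfolding m_def by blast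
qed

text \<open>The shifts for \<open>N\<close> and \<open>N + 1\<close> differ by at most \<open>3 \<epsilon> N\<close>, while the corresponding multiples of \<open>\<alpha>\<close>
  differ by at most \<open>2 A / N\<close> modulo 1. This is less than the separation of distinct points, so all
  shifts coincide, and \<open>N\<close> can be sent to infinity with the shift fixed.\<close>

lemma shifts_at_all_scales_imp_frac:
  assumes b: "0 < b" "b < 1" and A: "0 < A" and \<epsilon>: "0 < \<epsilon>" "6 * A * \<epsilon> < c"
    and scales: "\<And>N. N0 \<le> N \<Longrightarrow> \<exists>m k :: int. \<bar>of_int m\<bar> \<le> \<epsilon> * real N \<and>
      \<bar>of_int m * \<alpha> - b - of_int k\<bar> \<le> A / real N"
  shows "\<exists>m :: int. b = frac (of_int m * \<alpha>)"
proof -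
  define N1 where "N1 = Suc N0"
  obtain m k where m: "\<And>N. N1 \<le> N \<Longrightarrow> \<bar>real_of_int (m N)\<bar> \<le> \<epsilon> * real N"
    and k: "\<And>N. N1 \<le> N \<Longrightarrow> \<bar>of_int (m N) * \<alpha> - b - of_int (k N)\<bar> \<le> A / real N"
    using scales unfolding N1_def by (metis Suc_leD)
  have "m (Suc N) = m N" if N: "N1 \<le> N" for N
  proof (rule ccontr)
    assume neq: "m (Suc N) \<noteq> m N"
    have N0: "1 \<le> real N" using N unfolding N1_def by simp
    have "\<epsilon> * real (Suc N) \<le> \<epsilon> * (2 * real N)" using N0 \<epsilon>(1) by (intro mult_left_mono) auto
    then have "\<bar>real_of_int (m (Suc N) - m N)\<bar> \<le> 3 * \<epsilon> * real N"
      using m[OF N] m[OF le_SucI[OF N]] unfolding of_int_diff by linarith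
    then have "c / (3 * \<epsilon> * real N) \<le> \<bar>of_int (m (Suc N) - m N) * \<alpha> - of_int (k (Suc N) - k N)\<bar>"
      using neq by (intro separation_le) auto
    also have "of_int (m (Suc N) - m N) * \<alpha> - of_int (k (Suc N) - k N) =
        (of_int (m (Suc N)) * \<alpha> - b - of_int (k (Suc N))) - (of_int (m N) * \<alpha> - b - of_int (k N))"
      by (simp add: algebra_simps)
    also have "\<bar>\<dots>\<bar> \<le> A / real (Suc N) + A / real N"
      using k[OF N] k[OF le_SucI[OF N]] by linarith
    also have "A / real (Suc N) \<le> A / real N" using A N0 by (intro divide_left_mono) auto
    finally have "c / (3 * \<epsilon> * real N) \<le> 2 * A / real N" by simp
    then have "c \<le> 6 * A * \<epsilon>" using N0 \<epsilon>(1) by (simp add: field_simps)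
    then show False using \<epsilon>(2) by simp
  qed
  then have m_const: "m (N1 + j) = m N1" for j by (induction j) auto
  define z where "z = of_int (m N1) * \<alpha> - b"
  have "frac z = 0"
  proof (rule ccontr)
    assume "frac z \<noteq> 0"
    define r where "r = min (frac z) (1 - frac z)"
    have "0 < frac z" using \<open>frac z \<noteq> 0\<close> frac_ge_0[of z] by (metis less_le)
    then have r0: "0 < r" using frac_lt_1[of z] unfolding r_def by simp
    have far: "r \<le> \<bar>z - of_int i\<bar>" for i
    proof (cases "i \<le> \<lfloor>z\<rfloor>")
      case True
      then show ?thesis unfolding r_def frac_def by linarith
    next
      case False
      then have "real_of_int \<lfloor>z\<rfloor> + 1 \<le> of_int i" by linarith
      then show ?thesis unfolding r_def frac_def by linarith
    qed
    obtain j :: nat where "A / r < j" using reals_Archimedean2 by blast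
    then have "A / r < real (N1 + j)" by simp
    then have "A / real (N1 + j) < r" using r0 by (simp add: field_simps N1_def)
    then show False using k[of "N1 + j"] far[of "k (N1 + j)"] unfolding m_const z_def by simp
  qed
  then have "z \<in> \<int>" by simp
  then obtain i where "z = of_int i" by (auto elim: Ints_cases)
  then have "of_int (m N1) * \<alpha> = b + of_int i" unfolding z_def by simp
  then have "frac (of_int (m N1) * \<alpha>) = frac b" by (simp add: frac_add_of_int)
  also have "frac b = b" using b by (simp add: frac_eq)
  finally show ?thesis by metis
qed

text \<open>The infimum \<open>M\<close> of the rates \<open>r\<close> with \<open>\<bar>twisted_sum\<bar> \<le> r K\<close> for some \<open>K\<close> and all starting points is,
  by subadditivity, the growth rate of the sums. If it were positive, the cocycle would be nearly
  trivial along every good denominator \<open>q\<close>, so that \<open>b\<close> would be within \<open>A / q\<close> of a multiple \<open>m \<alpha>\<close>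
  with \<open>\<bar>m\<bar>\<close> small compared with \<open>q\<close>, at all scales.\<close>

theorem twisted_sum_small:
  fixes \<epsilon> :: real
  assumes \<omega>: "norm \<omega> = 1" "\<omega> \<noteq> 1" and b: "0 < b" "b < 1" and l: "0 \<le> l" "l \<le> 1"
    and b_orbit: "\<And>m :: int. b \<noteq> frac (of_int m * \<alpha>)" and "0 < \<epsilon>"
  shows "\<exists>N0. \<forall>N\<ge>N0::nat. \<forall>x. norm (twisted_sum \<alpha> b \<omega> s l N x) \<le> \<epsilon> * N"
proof -
  define G where "G N x = norm (twisted_sum \<alpha> b \<omega> s l N x)" for N x
  define R where "R = {r. 0 \<le> r \<and> (\<exists>K>0. \<forall>x. G K x \<le> r * real K)}"
  have bdd: "bdd_below R" by (rule bdd_belowI[of R 0]) (simp add: R_def)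
  have R1: "1 \<in> R"
    unfolding R_def G_def using norm_twisted_sum_le[OF \<omega>(1)] by (auto intro!: exI[of _ "1 :: nat"])
  define M where "M = Inf R"
  have M1: "M \<le> 1" unfolding M_def using R1 bdd by (rule cInf_lower)
  have "R \<noteq> {}" using R1 by blast
  then have M0: "0 \<le> M" unfolding M_def by (rule cInf_greatest) (simp add: R_def)
  have upper: "\<exists>K>0. \<forall>x. G K x \<le> (M + \<delta>) * K" if "0 < \<delta>" for \<delta>
  proof -
    have "\<exists>r\<in>R. r < M + \<delta>"
      using that \<open>R \<noteq> {}\<close> unfolding M_def by (intro cInf_lessD) auto
    then obtain r where r: "r \<in> R" "r < M + \<delta>" by blast
    then obtain K where K: "0 < K" "\<And>x. G K x \<le> r * real K" unfolding R_def by blast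
    have "G K x \<le> (M + \<delta>) * K" for x
      using K(2)[of x] mult_right_mono[of r "M + \<delta>" "real K"] r(2) by simp
    then show ?thesis using K(1) by blast
  qed
  have lower: "\<exists>x. r * real N < G N x" if "r < M" "0 < N" for r N
  proof (rule ccontr)
    assume "\<not> ?thesis"
    then have *: "\<And>x. G N x \<le> r * real N" by (auto simp: not_less)
    moreover have "0 \<le> G N 0" unfolding G_def by simp
    ultimately have "0 \<le> r * real N" by (meson order_trans)
    then have "0 \<le> r" using that(2) by (simp add: zero_le_mult_iff)
    then have "r \<in> R" using * that(2) unfolding R_def by blast
    then have "M \<le> r" unfolding M_def using bdd by (rule cInf_lower)
    then show False using that(1) by simp
  qed
  have "M = 0"
  proof (rule ccontr)
    assume "M \<noteq> 0"
    then have Mpos: "0 < M" using M0 by simp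
    \<comment> \<open>\<open>A / q\<close> is the length of the arcs next to the discontinuities. The bound \<open>c / 8\<close> separates the shifts
      \<open>m\<close> for one \<open>q\<close>, the bound on \<open>e\<close> those for consecutive scales.\<close>
    define A where "A = Min {c / 8, b, 1 - b}"
    have A: "0 < A" "8 * A \<le> c" "A \<le> b" "A \<le> 1 - b"
      unfolding A_def using c_pos b by (auto simp: min_def)
    define e where "e = min (1 / 2) (c\<^sup>2 / (12 * A))"
    have e: "0 < e" "e < 1" "12 * A * e \<le> c\<^sup>2"
      unfolding e_def using c_pos A by (auto simp: min_def field_simps)
    \<comment> \<open>With arcs of length \<open>d = A / q\<close>, a proportion \<open>\<delta> = d / 2 * (e * q)\<close> of bad times allows at most \<open>e * q\<close>
      uncompensated discontinuities.\<close>
    define \<delta> where "\<delta> = A * e / 2"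
    have \<delta>: "0 < \<delta>" unfolding \<delta>_def using A e by simp
    have b': "0 \<le> b" "b \<le> 1" using b by auto
    have \<tau>: "0 < norm (1 - \<omega>) / 2" using \<omega>(2) by simp
    obtain \<eta> where \<eta>: "0 < \<eta>" and near: "\<And>q p. \<bar>real q * \<alpha> - of_int p\<bar> \<le> \<eta> \<Longrightarrow>
      \<exists>N0. \<forall>N\<ge>N0::nat. \<exists>x. real (card {j. j < N \<and> norm (1 - \<omega>) / 2 \<le>
        norm (1 - cocycle \<alpha> b \<omega> q (x + real j * \<alpha>))}) \<le> \<delta> * N"
      using cocycle_nearly_trivial[OF \<omega>(1) b' l Mpos M1 \<tau> \<delta> upper[unfolded G_def] lower[unfolded G_def]]
      by blast
    obtain N0 :: nat where N0: "1 / \<eta> < N0" using reals_Archimedean2 by blast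
    have "\<exists>m k :: int. \<bar>of_int m\<bar> \<le> e * real N \<and> \<bar>of_int m * \<alpha> - b - of_int k\<bar> \<le> (A / c) / real N"
      if N: "N0 \<le> N" for N
    proof -
      have "0 < 1 / \<eta>" using \<eta> by simp
      then have Npos: "0 < real N" and N\<eta>: "1 / \<eta> < N" using N0 N by linarith+
      then have "0 < N" by simp
      then obtain p q' :: int where q': "0 < q'" "c * N \<le> of_int q'" "of_int q' \<le> real N"
        "\<bar>of_int q' * \<alpha> - of_int p\<bar> < 1 / N"
        using good_denominator by metis
      define q where "q = nat q'"
      have q: "0 < q" "c * N \<le> real q" "real q \<le> real N" "\<bar>real q * \<alpha> - of_int p\<bar> < 1 / N"
        using q' unfolding q_def by auto
      have "1 / N < \<eta>" using N\<eta> Npos \<eta> by (simp add: field_simps)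
      then have near_q: "\<bar>real q * \<alpha> - of_int p\<bar> \<le> \<eta>" using q(4) by linarith
      define d where "d = A / q"
      have qr: "1 \<le> real q" using q(1) by simp
      have "d \<le> A / 1" unfolding d_def using A qr by (intro divide_left_mono) auto
      then have d: "0 < d" "d \<le> b" "d \<le> 1 - b" using A q(1) unfolding d_def by auto
      have d2: "2 * d < c / (2 * q)" "2 * d < c / q"
        unfolding d_def using A c_pos q(1) by (auto simp: field_simps)
      from isolated_discontinuities_le[OF \<omega>(1) q(1) d d2(2) near[OF near_q]]
      have few: "card {i. i < q \<and> (\<forall>i'<q. \<forall>k :: int. d < \<bar>(real i' - real i) * \<alpha> - b - of_int k\<bar>)} \<le> e * q"
        unfolding \<delta>_def using A qr unfolding d_def by (simp add: field_simps)
      obtain m k :: int where mk: "\<bar>of_int m\<bar> \<le> e * q" "\<bar>of_int m * \<alpha> - b - of_int k\<bar> \<le> d"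
        using small_shift[OF q(1) d(1) d2(1) few e(2)] by blast
      have "e * q \<le> e * N" using q(3) e(1) by (intro mult_left_mono) auto
      moreover have "d \<le> A / (c * N)"
        unfolding d_def using q(1,2) A c_pos Npos by (intro divide_left_mono mult_pos_pos) auto
      ultimately show ?thesis using mk by (intro exI[of _ m] exI[of _ k]) auto
    qed
    moreover have "6 * (A / c) * e < c"
    proof -
      have "0 < A * e" using A e by simp
      then have "6 * (A * e) < c * c" using e(3) by (simp add: power2_eq_square)
      then show ?thesis using c_pos by (simp add: field_simps)
    qed
    ultimately show False
      using shifts_at_all_scales_imp_frac[OF b, of "A / c" e N0] A c_pos e(1) b_orbit by auto
  qed
  then obtain K where K: "0 < K" "\<And>x. G K x \<le> \<epsilon> / 2 * K" using upper[of "\<epsilon> / 2"] \<open>0 < \<epsilon>\<close> by auto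
  have blocks: "G (t * K + r) x \<le> t * (\<epsilon> / 2 * K) + r" for t r x
  proof (induction t arbitrary: x)
    case 0
    then show ?case unfolding G_def using norm_twisted_sum_le[OF \<omega>(1)] by simp
  next
    case (Suc t)
    have "G (K + (t * K + r)) x \<le> G K x + G (t * K + r) (x + real K * \<alpha>)"
      unfolding G_def twisted_sum_add
      by (rule order_trans[OF norm_triangle_ineq]) (simp add: norm_mult norm_cocycle[OF \<omega>(1)])
    also have "\<dots> \<le> \<epsilon> / 2 * K + (t * (\<epsilon> / 2 * K) + r)"
      using K(2) Suc.IH by (intro add_mono) auto
    finally show ?case by (simp add: algebra_simps add_divide_distrib)
  qed
  obtain N0 :: nat where N0: "2 * K / \<epsilon> < N0" using reals_Archimedean2 by blast
  have "G N x \<le> \<epsilon> * N" if N: "N0 \<le> N" for N x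
  proof -
    have "G N x \<le> (N div K) * (\<epsilon> / 2 * K) + (N mod K)"
      using blocks[of "N div K" "N mod K" x] by simp
    also have "\<dots> = \<epsilon> / 2 * real (N div K * K) + (N mod K)" by simp
    also have "\<dots> \<le> \<epsilon> / 2 * N + K"
      using \<open>0 < \<epsilon>\<close> K(1) mod_less_divisor[of K N]
      by (intro add_mono mult_left_mono) (auto simp del: of_nat_mult)
    also have "K \<le> \<epsilon> / 2 * N"
    proof -
      have "2 * K / \<epsilon> < N" using N0 N by linarith
      then show ?thesis using \<open>0 < \<epsilon>\<close> by (simp add: field_simps)
    qed
    finally show ?thesis by (simp add: algebra_simps)
  qed
  then show ?thesis unfolding G_def by blast
qed

end

section \<open>Distribution of the visited squares\<close>

text \<open>The square crossed after the \<open>j\<close>-th passage through a left edge, if passage 0 is at height \<open>x\<close> on the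
  left edge of square \<open>l\<close>. The height on arrival decides about the gate, hence the index \<open>Suc j\<close>.\<close>

primrec visited_square :: "nat \<Rightarrow> real \<Rightarrow> real \<Rightarrow> nat \<Rightarrow> real \<Rightarrow> nat \<Rightarrow> nat" where
  "visited_square n b \<alpha> l x 0 = l"
| "visited_square n b \<alpha> l x (Suc j) =
     (if frac (x + real (Suc j) * \<alpha>) < b then next_square n (visited_square n b \<alpha> l x j)
      else visited_square n b \<alpha> l x j)"

lemma next_square_range: "k \<in> {1..n} \<Longrightarrow> next_square n k \<in> {1..n}"
  unfolding next_square_def by auto

lemma visited_square_range: "l \<in> {1..n} \<Longrightarrow> visited_square n b \<alpha> l x j \<in> {1..n}"
proof (induction j)
  case (Suc j)
  then show ?case using next_square_range[of "visited_square n b \<alpha> l x j" n] by simp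
qed simp

lemma power_visited_square:
  assumes "\<omega> ^ n = 1"
  shows "\<omega> ^ visited_square n b \<alpha> l x j = \<omega> ^ l * cocycle \<alpha> b \<omega> j (x + \<alpha>)"
proof (induction j)
  case (Suc j)
  have step: "\<omega> ^ next_square n k = \<omega> * \<omega> ^ k" for k
    using assms unfolding next_square_def by auto
  have eq: "x + real (Suc j) * \<alpha> = x + \<alpha> + real j * \<alpha>" by (simp add: algebra_simps)
  show ?case
    using Suc.IH unfolding cocycle_def visited_square.simps eq by (simp add: step)
qed (simp add: cocycle_def)

lemma twisted_sum_1: "norm (twisted_sum \<alpha> b 1 s l N x) = visits \<alpha> (s - x) l N"
proof -
  have "twisted_sum \<alpha> b 1 s l N x = (\<Sum>j<N. of_bool (frac (real j * \<alpha> - (s - x)) < l))"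
    unfolding twisted_sum_def cocycle_def by (intro sum.cong) (auto simp: algebra_simps)
  also have "\<dots> = of_nat (visits \<alpha> (s - x) l N)"
    unfolding visits_def by (simp add: sum_of_bool_eq Collect_conj_eq lessThan_def)
  finally show ?thesis by simp
qed

lemma roots_of_unity_sum:
  assumes "1 \<le> n"
  defines "\<rho> \<equiv> exp (2 * of_real pi * \<i> / of_nat n) :: complex"
  shows "(\<Sum>m<n. (\<rho> ^ m) ^ e) = of_nat n * of_bool (n dvd e)"
proof -
  have power: "\<rho> ^ e = exp (2 * of_real pi * \<i> * of_nat e / of_nat n)" for e
    unfolding \<rho>_def exp_of_nat_mult[symmetric] by (simp add: mult_ac)
  have eq1: "\<rho> ^ e = 1 \<longleftrightarrow> n dvd e" for e
    unfolding power by (rule complex_root_unity_eq_1[OF assms(1)])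
  have "(\<Sum>m<n. (\<rho> ^ m) ^ e) = (\<Sum>m<n. (\<rho> ^ e) ^ m)"
    by (simp add: mult.commute flip: power_mult)
  also have "\<dots> = of_nat n * of_bool (n dvd e)"
  proof (cases "n dvd e")
    case False
    have "(\<rho> ^ e) ^ n = 1" unfolding power_mult[symmetric] eq1 by simp
    then show ?thesis using False eq1[of e] by (subst geometric_sum) auto
  qed (use eq1[of e] in simp)
  finally show ?thesis .
qed

context badly_approximable_rotation
begin

text \<open>Fourier inversion in the number of the square modulo \<open>n\<close>: the trivial character contributes the
  visits to the arc, divided by \<open>n\<close>, and every other character contributes a twisted sum.\<close>

theorem visits_to_square_upper:
  assumes n: "1 \<le> n" and b: "0 < b" "b < 1" and b_orbit: "\<And>m :: int. b \<noteq> frac (of_int m * \<alpha>)"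
    and l: "l \<in> {1..n}" and k: "k \<in> {1..n}" and d: "0 \<le> d" "d \<le> 1" and "0 < \<epsilon>"
  shows "\<forall>\<^sub>F N in sequentially. real (card {j. j < N \<and> visited_square n b \<alpha> l x j = k \<and>
    frac (x + real j * \<alpha> - s) < d}) \<le> (d / n + \<epsilon>) * N"
proof -
  define \<rho> where "\<rho> = exp (2 * of_real pi * \<i> / of_nat n :: complex)"
  have norm_\<rho>: "norm (\<rho> ^ m) = 1" for m
    unfolding \<rho>_def by (simp add: norm_power)
  have \<rho>_eq1: "\<rho> ^ m = 1 \<longleftrightarrow> n dvd m" for m
    using complex_root_unity_eq_1[OF n, of m]
    unfolding \<rho>_def exp_of_nat_mult[symmetric] by (simp add: mult_ac)
  define T where "T m N = twisted_sum \<alpha> b (\<rho> ^ m) (s + \<alpha>) d N (x + \<alpha>)" for m N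
  have ev0: "\<forall>\<^sub>F N in sequentially. norm (T 0 N) \<le> (d + \<epsilon>) * N"
    using visits_upper[OF d(1) \<open>0 < \<epsilon>\<close>] unfolding T_def eventually_sequentially
    by (auto simp: twisted_sum_1)
  have "\<forall>\<^sub>F N in sequentially. norm (T m N) \<le> \<epsilon> * N" if "m \<in> {1..<n}" for m
  proof -
    have "\<rho> ^ m \<noteq> 1" using \<rho>_eq1[of m] that nat_dvd_not_less[of m n] by auto
    from twisted_sum_small[OF norm_\<rho> this b d b_orbit \<open>0 < \<epsilon>\<close>, where s = "s + \<alpha>"]
    show ?thesis unfolding T_def eventually_sequentially by blast
  qed
  then have "\<forall>\<^sub>F N in sequentially. \<forall>m\<in>{1..<n}. norm (T m N) \<le> \<epsilon> * N"
    by (simp add: eventually_ball_finite)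
  with ev0 show ?thesis
  proof eventually_elim
    case (elim N)
    define v where "v j = visited_square n b \<alpha> l x j" for j
    define A where "A = {j. j < N \<and> v j = k \<and> frac (x + real j * \<alpha> - s) < d}"
    have orth: "of_bool (v j = k) = (\<Sum>m<n. (\<rho> ^ m) ^ (v j + (n - k))) / (of_nat n :: complex)" for j
    proof -
      have v: "v j \<in> {1..n}" unfolding v_def by (rule visited_square_range[OF l])
      have "n dvd v j + (n - k) \<longleftrightarrow> v j = k"
      proof
        assume "n dvd v j + (n - k)"
        then obtain a where a: "v j + (n - k) = n * a" ..
        have "0 < n * a" "n * a < n * 2" unfolding a[symmetric] using v k by auto
        then have "a = 1" by simp
        then show "v j = k" using a k by auto
      qed (use k in auto)
      then show ?thesis using n unfolding \<rho>_def by (simp add: roots_of_unity_sum)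
    qed
    have T_eq: "(\<Sum>j<N. (\<rho> ^ m) ^ (v j + (n - k)) * of_bool (frac (x + real j * \<alpha> - s) < d)) =
        (\<rho> ^ m) ^ (l + (n - k)) * T m N" for m
    proof -
      have "(\<rho> ^ m) ^ n = 1" using \<rho>_eq1[of "m * n"] by (simp add: power_mult)
      from power_visited_square[OF this]
      show ?thesis
        unfolding T_def twisted_sum_def v_def power_add sum_distrib_left
        by (intro sum.cong refl) (simp add: algebra_simps)
    qed
    have "complex_of_real (real (card A)) = (\<Sum>j<N. of_bool (v j = k) * of_bool (frac (x + real j * \<alpha> - s) < d))"
      unfolding A_def by (simp add: sum_of_bool_eq Collect_conj_eq lessThan_def flip: of_bool_conj)
    also have "\<dots> = (\<Sum>j<N. \<Sum>m<n. (\<rho> ^ m) ^ (v j + (n - k)) *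
        of_bool (frac (x + real j * \<alpha> - s) < d) / of_nat n)"
      unfolding orth by (simp add: sum_distrib_right sum_divide_distrib)
    also have "\<dots> = (\<Sum>m<n. (\<rho> ^ m) ^ (l + (n - k)) * T m N / of_nat n)"
      by (subst sum.swap) (simp add: T_eq flip: sum_divide_distrib)
    finally have "real (card A) = norm (\<Sum>m<n. (\<rho> ^ m) ^ (l + (n - k)) * T m N / of_nat n)"
      by (metis norm_of_real abs_of_nat)
    also have "\<dots> \<le> (\<Sum>m<n. norm (T m N) / n)"
      by (rule sum_norm_le) (simp add: norm_mult norm_divide norm_power norm_\<rho>[unfolded norm_power])
    also have "\<dots> = norm (T 0 N) / n + (\<Sum>m\<in>{1..<n}. norm (T m N) / n)"
    proof -
      have "{..<n} = insert 0 {1..<n}" using n by auto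
      then show ?thesis by simp
    qed
    also have "\<dots> \<le> (d + \<epsilon>) * N / n + (\<Sum>m\<in>{1..<n}. \<epsilon> * N / n)"
      using elim by (intro add_mono sum_mono divide_right_mono) auto
    also have "\<dots> = (d / n + \<epsilon>) * N"
      using n by (simp add: of_nat_diff field_simps)
    finally show ?case unfolding A_def v_def .
  qed
qed

end

section \<open>Geodesics as explicit trajectories\<close>

text \<open>The representative of a surface point with \<open>l - 1 \<le> x < l\<close> and \<open>0 \<le> y < 1\<close>.\<close>

fun canonical :: "nat \<Rightarrow> real \<Rightarrow> square_point \<Rightarrow> square_point" where
  "canonical n b (l, x, y) =
     (if x \<noteq> real l then (l, x, frac y)
      else if frac y < b then (next_square n l, real (next_square n l) - 1, frac y)
      else (l, real l - 1, frac y))"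

lemma identified_canonical:
  assumes "0 < b" and "b < 1" and "identified n b p q"
  shows "canonical n b p = canonical n b q"
  using assms(3)
proof cases
  case (top_bottom l x)
  then show ?thesis by (simp add: frac_def)
next
  case (gate l y)
  then have "frac y = y" using assms(2) by (simp add: frac_eq)
  then show ?thesis using gate by simp
next
  case (barrier l y)
  then have "frac y = y" using assms(1) by (simp add: frac_eq)
  then show ?thesis using barrier by simp
qed

lemma surface_point_eq_imp_canonical_eq:
  assumes "0 < b" and "b < 1" and "surface_point n b p = surface_point n b q"
  shows "canonical n b p = canonical n b q"
proof -
  have "q \<in> surface_point n b q" unfolding surface_point_def equivclp_def by simp
  then have "equivclp (identified n b) p q" using assms(3) unfolding surface_point_def by blast
  then show ?thesis
    by (induction rule: equivclp_induct) (auto dest: identified_canonical[OF assms(1,2)])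
qed

lemma surface_point_canonical:
  assumes "0 < b" and "l \<in> {1..n}" and "(x, y) \<in> square l"
  shows "surface_point n b (canonical n b (l, x, y)) = surface_point n b (l, x, y)"
proof -
  have eq: "surface_point n b p = surface_point n b q" if "equivclp (identified n b) p q" for p q
    unfolding surface_point_def using that by (blast intro: equivclp_sym equivclp_trans)
  have step: "surface_point n b p = surface_point n b q" if "identified n b p q" for p q
    using that by (intro eq) (auto simp: equivclp_def symclp_def)
  have xy: "real l - 1 \<le> x" "x \<le> real l" "0 \<le> y" "y \<le> 1"
    using assms(3) unfolding square_def by auto
  have height: "surface_point n b (l, x, frac y) = surface_point n b (l, x, y)"
  proof (cases "y = 1")
    case True
    have "frac y = 0" using True by (simp add: frac_def)
    then show ?thesis
      using True step[OF identified.top_bottom[OF assms(2), of x b]] xy by simp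
  next
    case False
    then show ?thesis using xy by (simp add: frac_eq)
  qed
  have edge: "surface_point n b (canonical n b (l, real l, y)) = surface_point n b (l, real l, frac y)"
  proof (cases "frac y < b")
    case True
    then show ?thesis using step[OF identified.gate[OF assms(2), of "frac y" b]] by simp
  next
    case False
    then show ?thesis
      using step[OF identified.barrier[OF assms(2), of b "frac y"]] frac_lt_1[of y] by simp
  qed
  show ?thesis
  proof (cases "x = real l")
    case True
    then show ?thesis using edge height by simp
  next
    case False
    then show ?thesis using height by simp
  qed
qed

text \<open>The position after horizontal distance \<open>r\<close> of the trajectory whose backward extension leaves the
  left edge of square \<open>l\<close> at height \<open>x\<close>.\<close>

definition trajectory :: "nat \<Rightarrow> real \<Rightarrow> real \<Rightarrow> nat \<Rightarrow> real \<Rightarrow> real \<Rightarrow> square_point" where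
  "trajectory n b \<alpha> l x r =
     (visited_square n b \<alpha> l x (nat \<lfloor>r\<rfloor>),
      real (visited_square n b \<alpha> l x (nat \<lfloor>r\<rfloor>)) - 1 + frac r, frac (x + \<alpha> * r))"

lemma frac_add_cong: "frac u = frac v \<Longrightarrow> frac (u + w) = frac (v + w :: real)"
proof -
  assume "frac u = frac v"
  then have "u + w = v + w + of_int (\<lfloor>u\<rfloor> - \<lfloor>v\<rfloor>)" unfolding frac_def by simp
  then show ?thesis by (simp only: frac_add_of_int)
qed

lemma canonical_trajectory: "canonical n b (trajectory n b \<alpha> l x r) = trajectory n b \<alpha> l x r"
  unfolding trajectory_def using frac_lt_1[of r] by simp

lemma trajectory_within_square:
  assumes at: "trajectory n b \<alpha> l x r = (k, px, frac py)" and "0 \<le> h" and "px + h < k"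
  shows "trajectory n b \<alpha> l x (r + h) = (k, px + h, frac (py + \<alpha> * h))"
proof -
  have px: "px = real k - 1 + frac r" and y: "frac (x + \<alpha> * r) = frac py"
    and k: "visited_square n b \<alpha> l x (nat \<lfloor>r\<rfloor>) = k"
    using at unfolding trajectory_def by auto
  have "\<lfloor>r + h\<rfloor> = \<lfloor>r\<rfloor>"
    using assms(2,3) px of_int_floor_le[of r] unfolding frac_def by (intro floor_unique) linarith+
  moreover from this have "frac (r + h) = frac r + h" unfolding frac_def by simp
  moreover have eq: "x + \<alpha> * (r + h) = x + \<alpha> * r + \<alpha> * h" by (simp add: algebra_simps)
  have "frac (x + \<alpha> * (r + h)) = frac (py + \<alpha> * h)" unfolding eq by (rule frac_add_cong[OF y])
  ultimately show ?thesis
    using px k unfolding trajectory_def by simp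
qed

lemma trajectory_at_edge:
  assumes at: "trajectory n b \<alpha> l x r = (k, px, frac py)" and "0 \<le> r" and edge: "px + h = k"
  shows "trajectory n b \<alpha> l x (r + h) = canonical n b (k, real k, py + \<alpha> * h)"
proof -
  have px: "px = real k - 1 + frac r" and y: "frac (x + \<alpha> * r) = frac py"
    and k: "visited_square n b \<alpha> l x (nat \<lfloor>r\<rfloor>) = k"
    using at unfolding trajectory_def by auto
  have r: "r + h = real (Suc (nat \<lfloor>r\<rfloor>))"
    using edge px assms(2) unfolding frac_def by simp
  have eq: "x + \<alpha> * (r + h) = x + \<alpha> * r + \<alpha> * h" by (simp add: algebra_simps)
  have y': "frac (x + \<alpha> * (r + h)) = frac (py + \<alpha> * h)" unfolding eq by (rule frac_add_cong[OF y])
  have fl: "\<lfloor>r + h\<rfloor> = int (Suc (nat \<lfloor>r\<rfloor>))" unfolding r by (rule floor_of_nat)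
  have "nat \<lfloor>r + h\<rfloor> = Suc (nat \<lfloor>r\<rfloor>)" unfolding fl by (rule nat_int)
  moreover have "frac (r + h) = 0" unfolding frac_def fl unfolding r by simp
  moreover have "frac (x + real (Suc (nat \<lfloor>r\<rfloor>)) * \<alpha>) = frac (py + \<alpha> * h)"
    using y' unfolding r by (simp add: mult.commute)
  ultimately show ?thesis
    unfolding trajectory_def y' by (simp add: k del: of_nat_Suc)
qed

text \<open>Equality of surface points is equality of canonical representatives. Hence a geodesic that agrees with
  the explicit trajectory at time \<open>t\<close> starts its next segment at the canonical representative and
  follows the trajectory for a while; and if it agrees before time \<open>t\<close>, then the segment ending at time
  \<open>t\<close> stays inside the square or reaches the right edge, where \<open>canonical\<close> selects the next square by
  the rule for \<open>visited_square\<close>. The infimum of the times of disagreement therefore cannot exist.\<close>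

theorem geodesic_eq_trajectory:
  assumes b: "0 < b" "b < 1" and L: "half_infinite_geodesic n b \<alpha> L"
  defines "\<sigma> \<equiv> 1 / sqrt (1 + \<alpha>\<^sup>2)"
  obtains l x a where "l \<in> {1..n}" and "0 \<le> a"
    and "\<And>t. 0 \<le> t \<Longrightarrow> L t = surface_point n b (trajectory n b \<alpha> l x (a + \<sigma> * t))"
proof -
  have "0 < 1 + \<alpha>\<^sup>2" by (simp add: add_pos_nonneg)
  then have \<sigma>0: "0 < \<sigma>" unfolding \<sigma>_def by simp
  have u: "s *\<^sub>R unit_direction \<alpha> = (\<sigma> * s, \<alpha> * (\<sigma> * s))" for s
    unfolding unit_direction_def \<sigma>_def[symmetric] by simp
  have fwd: "\<exists>\<epsilon>>0. \<exists>l\<in>{1..n}. \<exists>px py. \<forall>s\<in>{0..\<epsilon>}. (px + \<sigma> * s, py + \<alpha> * (\<sigma> * s)) \<in> square l \<and>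
      L (t + s) = surface_point n b (l, px + \<sigma> * s, py + \<alpha> * (\<sigma> * s))" if "0 \<le> t" for t
  proof -
    have "\<exists>\<epsilon>>0. \<exists>l\<in>{1..n}. \<exists>p. \<forall>s\<in>{0..\<epsilon>}. p + s *\<^sub>R unit_direction \<alpha> \<in> square l \<and>
        L (t + s) = surface_point n b (l, p + s *\<^sub>R unit_direction \<alpha>)"
      using conjunct1[OF L[unfolded half_infinite_geodesic_def]] that by (elim allE impE)
    then obtain \<epsilon> l px py where *: "0 < \<epsilon>" "l \<in> {1..n}" and
      "\<forall>s\<in>{0..\<epsilon>}. (px, py) + s *\<^sub>R unit_direction \<alpha> \<in> square l \<and>
        L (t + s) = surface_point n b (l, (px, py) + s *\<^sub>R unit_direction \<alpha>)"
      by (elim exE conjE bexE) (metis surj_pair)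
    from this(3) show ?thesis
      unfolding u add_Pair by (intro exI[of _ \<epsilon>] conjI * bexI[of _ l] exI)
  qed
  have bwd: "\<exists>\<epsilon>\<in>{0<..t}. \<exists>l\<in>{1..n}. \<exists>px py. \<forall>s\<in>{0..\<epsilon>}. (px - \<sigma> * s, py - \<alpha> * (\<sigma> * s)) \<in> square l \<and>
      L (t - s) = surface_point n b (l, px - \<sigma> * s, py - \<alpha> * (\<sigma> * s))" if "0 < t" for t
  proof -
    have "\<exists>\<epsilon>\<in>{0<..t}. \<exists>l\<in>{1..n}. \<exists>p. \<forall>s\<in>{0..\<epsilon>}. p - s *\<^sub>R unit_direction \<alpha> \<in> square l \<and>
        L (t - s) = surface_point n b (l, p - s *\<^sub>R unit_direction \<alpha>)"
      using conjunct2[OF L[unfolded half_infinite_geodesic_def]] that by (elim allE impE)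
    then obtain \<epsilon> l px py where *: "\<epsilon> \<in> {0<..t}" "l \<in> {1..n}" and
      "\<forall>s\<in>{0..\<epsilon>}. (px, py) - s *\<^sub>R unit_direction \<alpha> \<in> square l \<and>
        L (t - s) = surface_point n b (l, (px, py) - s *\<^sub>R unit_direction \<alpha>)"
      by (elim exE conjE bexE) (metis surj_pair)
    from this(3) show ?thesis
      unfolding u diff_Pair by (intro bexI[of _ \<epsilon>] * bexI[of _ l] exI)
  qed
  obtain \<epsilon>0 l px0 py0 where start: "0 < \<epsilon>0" "l \<in> {1..n}" "\<And>s. s \<in> {0..\<epsilon>0} \<Longrightarrow>
      (px0 + \<sigma> * s, py0 + \<alpha> * (\<sigma> * s)) \<in> square l \<and>
      L s = surface_point n b (l, px0 + \<sigma> * s, py0 + \<alpha> * (\<sigma> * s))"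
    using fwd[OF order_refl, unfolded add_0] by blast
  define a where "a = px0 - (real l - 1)"
  define x where "x = py0 - \<alpha> * a"
  define E where "E t = trajectory n b \<alpha> l x (a + \<sigma> * t)" for t
  define P where "P t \<longleftrightarrow> L t = surface_point n b (E t)" for t
  have a: "0 \<le> a" using start(3)[of 0] start(1) unfolding a_def square_def by auto
  have "px0 + \<sigma> * \<epsilon>0 \<le> l" using start(3)[of \<epsilon>0] start(1) unfolding square_def by auto
  moreover have "0 < \<sigma> * \<epsilon>0" using \<sigma>0 start(1) by simp
  ultimately have px0: "px0 < real l" by linarith
  then have a1: "a < 1" unfolding a_def by simp
  have canon: "canonical n b (k, px, py) = E t" if "surface_point n b (k, px, py) = L t" "P t" for k px py t
  proof -
    have "canonical n b (k, px, py) = canonical n b (E t)"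
      using that b unfolding P_def by (intro surface_point_eq_imp_canonical_eq) auto
    then show ?thesis unfolding E_def canonical_trajectory .
  qed
  have P_canonical: "P t" if "L t = surface_point n b (k, px, py)" "(px, py) \<in> square k" "k \<in> {1..n}"
    "canonical n b (k, px, py) = E t" for k px py t
    using that surface_point_canonical[OF b(1) that(3,2)] unfolding P_def by simp
  have P0: "P 0"
  proof (rule P_canonical)
    have "\<lfloor>a\<rfloor> = 0" using a a1 by (intro floor_unique) auto
    then show "canonical n b (l, px0, py0) = E 0"
      using px0 unfolding E_def trajectory_def x_def by (simp add: frac_def a_def)
  qed (use start(3)[of 0] start(1,2) in auto)
  have forward: "\<exists>\<epsilon>>0. \<forall>s\<in>{0..\<epsilon>}. P (t + s)" if t: "0 \<le> t" "P t" for t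
  proof -
    obtain \<epsilon> k px py where k: "0 < \<epsilon>" "k \<in> {1..n}" and seg: "\<And>s. s \<in> {0..\<epsilon>} \<Longrightarrow>
        (px + \<sigma> * s, py + \<alpha> * (\<sigma> * s)) \<in> square k \<and>
        L (t + s) = surface_point n b (k, px + \<sigma> * s, py + \<alpha> * (\<sigma> * s))"
      using fwd[OF t(1)] by blast
    have stop: "px + \<sigma> * \<epsilon> \<le> k" using seg[of \<epsilon>] k(1) unfolding square_def by auto
    have lt: "px + \<sigma> * s < k" if "s < \<epsilon>" for s
      using stop mult_strict_left_mono[OF that \<sigma>0] by linarith
    have "canonical n b (k, px, py) = E t" using seg[of 0] k(1) t(2) by (intro canon) auto
    then have at: "trajectory n b \<alpha> l x (a + \<sigma> * t) = (k, px, frac py)"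
      using lt[of 0] k(1) unfolding E_def by simp
    have "P (t + s)" if s: "s \<in> {0..\<epsilon> / 2}" for s
    proof (rule P_canonical)
      have s': "s \<in> {0..\<epsilon>}" "s < \<epsilon>" using s k(1) by auto
      show "L (t + s) = surface_point n b (k, px + \<sigma> * s, py + \<alpha> * (\<sigma> * s))"
        "(px + \<sigma> * s, py + \<alpha> * (\<sigma> * s)) \<in> square k" "k \<in> {1..n}"
        using seg[OF s'(1)] k(2) by auto
      have r: "a + \<sigma> * (t + s) = a + \<sigma> * t + \<sigma> * s" by (simp add: algebra_simps)
      show "canonical n b (k, px + \<sigma> * s, py + \<alpha> * (\<sigma> * s)) = E (t + s)"
        using trajectory_within_square[OF at, of "\<sigma> * s"] lt[OF s'(2)] s' \<sigma>0 unfolding E_def r by simp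
    qed
    then show ?thesis using k(1) by (intro exI[of _ "\<epsilon> / 2"]) auto
  qed
  have backward: "P t" if t: "0 < t" and before: "\<And>s. 0 \<le> s \<Longrightarrow> s < t \<Longrightarrow> P s" for t
  proof -
    obtain \<epsilon> k px py where k: "\<epsilon> \<in> {0<..t}" "k \<in> {1..n}" and seg: "\<And>s. s \<in> {0..\<epsilon>} \<Longrightarrow>
        (px - \<sigma> * s, py - \<alpha> * (\<sigma> * s)) \<in> square k \<and>
        L (t - s) = surface_point n b (k, px - \<sigma> * s, py - \<alpha> * (\<sigma> * s))"
      using bwd[OF t] by blast
    have sq: "(px, py) \<in> square k" "L t = surface_point n b (k, px, py)" using seg[of 0] k(1) by auto
    have "0 < \<sigma> * \<epsilon>" using \<sigma>0 k(1) by simp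
    moreover have px: "px \<le> k" using sq(1) unfolding square_def by auto
    ultimately have lt: "px - \<sigma> * \<epsilon> < k" by linarith
    have "canonical n b (k, px - \<sigma> * \<epsilon>, py - \<alpha> * (\<sigma> * \<epsilon>)) = E (t - \<epsilon>)"
      using seg[of \<epsilon>] k(1) before[of "t - \<epsilon>"] by (intro canon) auto
    then have at: "trajectory n b \<alpha> l x (a + \<sigma> * (t - \<epsilon>)) = (k, px - \<sigma> * \<epsilon>, frac (py - \<alpha> * (\<sigma> * \<epsilon>)))"
      using lt unfolding E_def by simp
    have r0: "0 \<le> a + \<sigma> * (t - \<epsilon>)" using a \<sigma>0 k(1) by simp
    have r: "a + \<sigma> * (t - \<epsilon>) + \<sigma> * \<epsilon> = a + \<sigma> * t" by (simp add: algebra_simps)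
    have "canonical n b (k, px, py) = E t"
    proof (cases "px = k")
      case True
      then show ?thesis
        using trajectory_at_edge[OF at r0, of "\<sigma> * \<epsilon>"] unfolding r E_def by simp
    next
      case False
      then show ?thesis
        using trajectory_within_square[OF at, of "\<sigma> * \<epsilon>"] \<open>0 < \<sigma> * \<epsilon>\<close> px unfolding r E_def by simp
    qed
    then show ?thesis using sq k(2) by (intro P_canonical) auto
  qed
  have "P t" if "0 \<le> t" for t
  proof (rule ccontr)
    assume "\<not> P t"
    define B where "B = {t. 0 \<le> t \<and> \<not> P t}"
    have B: "t \<in> B" "bdd_below B"
      using \<open>\<not> P t\<close> that unfolding B_def by (auto intro: bdd_belowI[of _ 0])
    define T where "T = Inf B"
    have T0: "0 \<le> T" unfolding T_def using B(1) by (intro cInf_greatest) (auto simp: B_def)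
    have before: "P s" if "0 \<le> s" "s < T" for s
    proof (rule ccontr)
      assume "\<not> P s"
      then have "s \<in> B" using that(1) unfolding B_def by simp
      then have "T \<le> s" unfolding T_def using B(2) by (rule cInf_lower)
      then show False using that(2) by simp
    qed
    have "P T"
    proof (cases "T = 0")
      case False
      then have "0 < T" using T0 by simp
      then show ?thesis using before by (rule backward)
    qed (use P0 in simp)
    then obtain \<epsilon> where \<epsilon>: "0 < \<epsilon>" "\<And>s. s \<in> {0..\<epsilon>} \<Longrightarrow> P (T + s)" using forward[OF T0] by blast
    have "T + \<epsilon> \<le> s" if "s \<in> B" for s
    proof (rule ccontr)
      assume "\<not> T + \<epsilon> \<le> s"
      moreover have "T \<le> s" unfolding T_def using that B(2) by (rule cInf_lower)
      ultimately have "P (T + (s - T))" by (intro \<epsilon>(2)) auto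
      then show False using that unfolding B_def by simp
    qed
    then have "T + \<epsilon> \<le> Inf B" using B(1) by (intro cInf_greatest) auto
    then show False using \<epsilon>(1) unfolding T_def by simp
  qed
  then show thesis using start(2) a that unfolding P_def E_def by blast
qed

section \<open>Covering by cells\<close>

text \<open>The squares are cut into \<open>R\<^sup>2\<close> columns and \<open>R\<close> rows: a trajectory crosses a column with a change of
  height that is small compared with the height of a row.\<close>

definition cell :: "nat \<Rightarrow> nat \<Rightarrow> nat \<Rightarrow> nat \<Rightarrow> (real \<times> real) set" where
  "cell R k p q = {real k - 1 + real p / real (R\<^sup>2)..<real k - 1 + real (Suc p) / real (R\<^sup>2)} \<times>
     {real q / real R..<real (Suc q) / real R}"

definition met_cells :: "nat \<Rightarrow> nat \<Rightarrow> (real \<times> real) set \<Rightarrow> (nat \<times> nat) set" where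
  "met_cells R k S = {(p, q). p < R\<^sup>2 \<and> q < R \<and> cell R k p q \<inter> S \<noteq> {}}"

lemma finite_met_cells: "finite (met_cells R k S)"
  by (rule finite_subset[of _ "{..<R\<^sup>2} \<times> {..<R}"]) (auto simp: met_cells_def)

lemma column_index_eq:
  fixes u r :: real and p p' :: nat
  assumes "0 < r" and "u \<in> {c + real p / r..<c + real (Suc p) / r}" and "u \<in> {c + real p' / r..<c + real (Suc p') / r}"
  shows "p = p'"
proof -
  have "(u - c) * r \<in> {real p..<real (Suc p)}" "(u - c) * r \<in> {real p'..<real (Suc p')}"
    using assms by (auto simp: field_simps)
  then show ?thesis by auto
qed

lemma cell_disjoint:
  assumes "0 < R" and "z \<in> cell R k p q" and "z \<in> cell R k p' q'"
  shows "p = p' \<and> q = q'"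
proof
  show "p = p'"
    using assms by (intro column_index_eq[of "real (R\<^sup>2)" "fst z" "real k - 1"]) (auto simp: cell_def)
  show "q = q'"
    using assms by (intro column_index_eq[of "real R" "snd z" 0]) (auto simp: cell_def)
qed

lemma emeasure_cell:
  assumes "0 < R"
  shows "cell R k p q \<in> sets lebesgue" and "emeasure lebesgue (cell R k p q) = ennreal (1 / real R ^ 3)"
proof -
  define u where "u = real k - 1 + real p / real (R\<^sup>2)"
  define v where "v = real q / real R"
  have cell_eq: "cell R k p q = {u..<u + 1 / real (R\<^sup>2)} \<times> {v..<v + 1 / real R}"
    unfolding cell_def u_def v_def by (simp add: add_divide_distrib algebra_simps)
  have "cell R k p q \<in> sets (lborel \<Otimes>\<^sub>M lborel)" unfolding cell_eq by (intro pair_measureI) auto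
  then have sets: "cell R k p q \<in> sets lborel" unfolding lborel_prod .
  then show "cell R k p q \<in> sets lebesgue" by simp
  have "emeasure lborel (cell R k p q) = emeasure (lborel \<Otimes>\<^sub>M lborel) (cell R k p q)"
    unfolding lborel_prod ..
  also have "\<dots> = emeasure lborel {u..<u + 1 / real (R\<^sup>2)} * emeasure lborel {v..<v + 1 / real R}"
    unfolding cell_eq by (rule lborel.emeasure_pair_measure_Times) auto
  also have "\<dots> = ennreal (1 / real R ^ 3)"
    by (simp add: ennreal_mult[symmetric] power2_eq_square power3_eq_cube)
  finally show "emeasure lebesgue (cell R k p q) = ennreal (1 / real R ^ 3)"
    using sets by (simp add: emeasure_completion)
qed

lemma measure_Union_cells:
  assumes "0 < R" and "finite J"
  shows "measure lebesgue (\<Union>(p, q)\<in>J. cell R k p q) = card J / real R ^ 3"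
proof -
  have "measure lebesgue (\<Union>z\<in>J. case z of (p, q) \<Rightarrow> cell R k p q) =
      (\<Sum>z\<in>J. measure lebesgue (case z of (p, q) \<Rightarrow> cell R k p q))"
  proof (rule measure_finite_Union[OF assms(2)])
    show "disjoint_family_on (\<lambda>z. case z of (p, q) \<Rightarrow> cell R k p q) J"
      unfolding disjoint_family_on_def using cell_disjoint[OF assms(1)] by fastforce
  qed (use emeasure_cell[OF assms(1)] in auto)
  also have "\<dots> = (\<Sum>z\<in>J. 1 / real R ^ 3)"
    using emeasure_cell[OF assms(1)] by (intro sum.cong) (auto simp: measure_def)
  finally show ?thesis by simp
qed

lemma cell_dist_le:
  assumes "0 < R" and "z \<in> cell R k p q" and "w \<in> cell R k p q"
  shows "dist z w \<le> 2 / real R"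
proof -
  have "\<bar>fst z - fst w\<bar> \<le> 1 / real (R\<^sup>2)"
    using assms(2,3) by (auto simp: cell_def add_divide_distrib abs_le_iff)
  also have "\<dots> \<le> 1 / real R"
    using assms(1) by (intro divide_left_mono) (auto simp: power2_eq_square)
  finally have x: "\<bar>fst z - fst w\<bar> \<le> 1 / real R" .
  have y: "\<bar>snd z - snd w\<bar> \<le> 1 / real R"
    using assms(2,3) by (auto simp: cell_def add_divide_distrib abs_le_iff)
  have "dist z w \<le> \<bar>fst z - fst w\<bar> + \<bar>snd z - snd w\<bar>"
    unfolding dist_prod_def dist_real_def by (rule order_trans[OF sqrt_sum_squares_le_sum_abs]) simp
  then show ?thesis using x y by simp
qed

text \<open>These cells lie in the closed neighbourhoods of radius \<open>2 / R\<close> of the set, whose area tends to the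
  area of the closure as \<open>R\<close> grows; for a Jordan measurable set this is the area of the set itself.\<close>

lemma met_cells_area:
  assumes S: "bounded S" "negligible (frontier S)" and "0 < \<epsilon>"
  shows "\<forall>\<^sub>F R in sequentially. card (met_cells R k S) / real R ^ 3 \<le> measure lebesgue S + \<epsilon>"
proof (cases "S = {}")
  case True
  then have "met_cells R k S = {}" for R unfolding met_cells_def by simp
  then show ?thesis using \<open>0 < \<epsilon>\<close> True by simp
next
  case False
  define K where "K = closure S"
  have K: "compact K" "K \<noteq> {}" unfolding K_def using S(1) False by (auto simp: compact_closure)
  define D where "D m = {z. infdist z K \<le> 2 / real (Suc m)}" for m
  have D: "compact (D m)" for m
    unfolding D_def by (rule compact_infdist_le) (use K in auto)
  have "(\<lambda>m. measure lebesgue (D m)) \<longlonglongrightarrow> measure lebesgue (\<Inter>m. D m)"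
  proof (rule Lim_measure_decseq)
    show "range D \<subseteq> sets lebesgue" using lmeasurable_compact[OF D] by (auto simp: fmeasurable_def)
    show "decseq D"
    proof (rule decseq_SucI)
      fix m
      have "2 / real (Suc (Suc m)) \<le> 2 / real (Suc m)" by (intro divide_left_mono) auto
      then show "D (Suc m) \<subseteq> D m" unfolding D_def by auto
    qed
    show "emeasure lebesgue (D m) \<noteq> \<infinity>" for m
      unfolding infinity_ennreal_def by (rule fmeasurableD2[OF lmeasurable_compact[OF D]])
  qed
  also have "(\<Inter>m. D m) = K"
  proof (intro subset_antisym subsetI)
    fix z assume z: "z \<in> (\<Inter>m. D m)"
    have "(\<lambda>m. 2 / real (Suc m)) \<longlonglongrightarrow> 0" using LIMSEQ_Suc[OF lim_const_over_n[of 2]] by simp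
    moreover have "infdist z K \<le> 2 / real (Suc m)" for m using z unfolding D_def by auto
    ultimately have "infdist z K \<le> 0" by (intro LIMSEQ_le_const) auto
    then have "infdist z K = 0" using infdist_nonneg[of z K] by simp
    then show "z \<in> K" using K by (simp add: in_closed_iff_infdist_zero compact_imp_closed)
  qed (auto simp: D_def)
  also have "measure lebesgue K = measure lebesgue S" unfolding K_def by (rule measure_closure[OF S])
  finally have "\<forall>\<^sub>F m in sequentially. measure lebesgue (D m) < measure lebesgue S + \<epsilon>"
    using \<open>0 < \<epsilon>\<close> by (intro order_tendstoD(2)) auto
  then have "\<forall>\<^sub>F m in sequentially. card (met_cells (Suc m) k S) / real (Suc m) ^ 3 \<le> measure lebesgue S + \<epsilon>"
  proof eventually_elim
    case (elim m)
    have "(\<Union>(p, q)\<in>met_cells (Suc m) k S. cell (Suc m) k p q) \<subseteq> D m"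
    proof clarify
      fix z1 z2 p q assume "(p, q) \<in> met_cells (Suc m) k S" and z: "(z1, z2) \<in> cell (Suc m) k p q"
      then obtain w where w: "w \<in> cell (Suc m) k p q" "w \<in> S" unfolding met_cells_def by auto
      have "infdist (z1, z2) K \<le> dist (z1, z2) w"
        using w(2) closure_subset[of S] unfolding K_def by (intro infdist_le) auto
      also have "\<dots> \<le> 2 / real (Suc m)" using z w(1) by (intro cell_dist_le) auto
      finally show "(z1, z2) \<in> D m" unfolding D_def by simp
    qed
    then have "measure lebesgue (\<Union>(p, q)\<in>met_cells (Suc m) k S. cell (Suc m) k p q) \<le> measure lebesgue (D m)"
      using emeasure_cell(1)[of "Suc m"] lmeasurable_compact[OF D] finite_met_cells[of "Suc m" k S]
      by (intro measure_mono_fmeasurable) (auto intro!: sets.finite_UN)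
    then show ?case
      using elim measure_Union_cells[of "Suc m" "met_cells (Suc m) k S" k] finite_met_cells by simp
  qed
  then show ?thesis
    by (subst (asm) eventually_sequentially_Suc[where P = "\<lambda>R. card (met_cells R k S) / real R ^ 3 \<le> measure lebesgue S + \<epsilon>"])
qed

lemma grid_index:
  fixes f :: real
  assumes "0 \<le> f" and "f < 1" and "0 < r"
  obtains p where "p < r" and "real p / r \<le> f" and "f < real (Suc p) / r"
proof -
  define p where "p = nat \<lfloor>f * r\<rfloor>"
  have "real p = of_int \<lfloor>f * r\<rfloor>" using assms unfolding p_def by simp
  then have p: "real p \<le> f * r" "f * r < real (Suc p)" by linarith+
  have "f * real r < 1 * real r" using assms by (intro mult_strict_right_mono) auto
  then have "real p < r" using p(1) by simp
  then show thesis using p assms(3) by (intro that[of p]) (auto simp: field_simps)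
qed

text \<open>While the trajectory is in a cell, the height at which it left the left edge of the square is
  confined to an arc slightly longer than a row.\<close>

lemma visiting_time_le_cells:
  assumes \<sigma>: "0 < \<sigma>" and a: "0 \<le> a" and l: "l \<in> {1..n}" and R: "0 < R" and T: "0 \<le> T"
    and L: "\<And>t. 0 \<le> t \<Longrightarrow> L t = surface_point n b (trajectory n b \<alpha> l x (a + \<sigma> * t))"
  defines "N \<equiv> Suc (nat \<lfloor>a + \<sigma> * T\<rfloor>)"
    and "d \<equiv> 1 / real R + 2 * \<bar>\<alpha>\<bar> / real (R\<^sup>2)"
    and "s \<equiv> \<lambda>p q. real q / real R - \<alpha> * (real p / real (R\<^sup>2)) - \<bar>\<alpha>\<bar> / real (R\<^sup>2)"
  shows "visiting_time L A T \<le> (\<Sum>k = 1..n. \<Sum>(p, q)\<in>met_cells R k (square_part n b A k).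
    real (card {j. j < N \<and> visited_square n b \<alpha> l x j = k \<and> frac (x + real j * \<alpha> - s p q) < d}) / (real (R\<^sup>2) * \<sigma>))"
proof -
  define M where "M k = met_cells R k (square_part n b A k)" for k
  define J where "J k p q = {j. j < N \<and> visited_square n b \<alpha> l x j = k \<and> frac (x + real j * \<alpha> - s p q) < d}" for k p q
  define I where "I j p = {(real j + real p / real (R\<^sup>2) - a) / \<sigma>..(real j + real (Suc p) / real (R\<^sup>2) - a) / \<sigma>}" for j p
  define U where "U = (\<Union>k\<in>{1..n}. \<Union>(p, q)\<in>M k. \<Union>j\<in>J k p q. I j p)"
  have fin: "finite (M k)" "finite (J k p q)" for k p q
    unfolding M_def J_def by (auto simp: finite_met_cells)
  have I: "I j p \<in> sets lebesgue" "measure lebesgue (I j p) = 1 / (real (R\<^sup>2) * \<sigma>)"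
    "emeasure lebesgue (I j p) < \<infinity>" for j p
    unfolding I_def using \<sigma> by (auto simp: add_divide_distrib diff_divide_distrib divide_right_mono)
  have "{t \<in> {0..T}. L t \<in> A} \<subseteq> U"
  proof
    fix t assume t: "t \<in> {t \<in> {0..T}. L t \<in> A}"
    define r where "r = a + \<sigma> * t"
    define j where "j = nat \<lfloor>r\<rfloor>"
    define k where "k = visited_square n b \<alpha> l x j"
    define y where "y = frac (x + \<alpha> * r)"
    have r0: "0 \<le> r" using t a \<sigma> unfolding r_def by simp
    then have rj: "r = real j + frac r" unfolding j_def frac_def by simp
    have "\<sigma> * t \<le> \<sigma> * T" using t \<sigma> by simp
    then have jN: "j < N" unfolding j_def N_def r_def by (auto intro!: nat_mono floor_mono simp: less_Suc_eq_le)
    have k: "k \<in> {1..n}" unfolding k_def by (rule visited_square_range[OF l])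
    have at: "trajectory n b \<alpha> l x r = (k, real k - 1 + frac r, y)"
      unfolding trajectory_def k_def y_def j_def ..
    have y: "0 \<le> y" "y < 1" unfolding y_def by (auto simp: frac_lt_1)
    have "(real k - 1 + frac r, y) \<in> square k"
      unfolding square_def using y frac_lt_1[of r] by auto
    moreover have "surface_point n b (k, real k - 1 + frac r, y) \<in> A"
      using L[of t] t unfolding r_def[symmetric] at by simp
    ultimately have in_part: "(real k - 1 + frac r, y) \<in> square_part n b A k"
      unfolding square_part_def by simp
    obtain p where p: "p < R\<^sup>2" "real p / real (R\<^sup>2) \<le> frac r" "frac r < real (Suc p) / real (R\<^sup>2)"
      using grid_index[of "frac r" "R\<^sup>2"] R by (auto simp: frac_lt_1)
    obtain q where q: "q < R" "real q / real R \<le> y" "y < real (Suc q) / real R"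
      using grid_index[OF y R] by blast
    have "(real k - 1 + frac r, y) \<in> cell R k p q" unfolding cell_def using p q by auto
    then have M: "(p, q) \<in> M k" unfolding M_def met_cells_def using p(1) q(1) in_part by blast
    define e where "e = \<alpha> * (real p / real (R\<^sup>2) - frac r) + \<bar>\<alpha>\<bar> / real (R\<^sup>2)"
    have "\<bar>real p / real (R\<^sup>2) - frac r\<bar> \<le> 1 / real (R\<^sup>2)"
      using p(2,3) by (simp add: add_divide_distrib)
    then have "\<bar>\<alpha> * (real p / real (R\<^sup>2) - frac r)\<bar> \<le> \<bar>\<alpha>\<bar> * (1 / real (R\<^sup>2))"
      unfolding abs_mult by (rule mult_left_mono) simp
    then have e: "0 \<le> e" "e \<le> 2 * \<bar>\<alpha>\<bar> / real (R\<^sup>2)" unfolding e_def by auto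
    define w where "w = x + \<alpha> * r - real q / real R"
    have "0 \<le> real q / real R" by simp
    then have "0 \<le> y - real q / real R" "y - real q / real R < 1" using q(2) y(2) by linarith+
    moreover have "w - (y - real q / real R) \<in> \<int>" unfolding w_def y_def frac_def by simp
    ultimately have "frac w = y - real q / real R" unfolding frac_unique_iff by simp
    then have w: "frac w < 1 / real R" using q(3) by (simp add: add_divide_distrib)
    have "\<alpha> * r = \<alpha> * real j + \<alpha> * frac r" by (metis rj distrib_left)
    then have shift: "x + real j * \<alpha> - s p q = w + e"
      unfolding w_def e_def s_def by (simp add: algebra_simps)
    have "frac (x + real j * \<alpha> - s p q) < d"
      using frac_add_nonneg_le[OF e(1), of w] w e(2) unfolding shift d_def by linarith
    then have J: "j \<in> J k p q" unfolding J_def k_def using jN by simp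
    have "t = (r - a) / \<sigma>" unfolding r_def using \<sigma> by simp
    then have "t \<in> I j p"
      unfolding I_def using p(2,3) \<sigma> rj by (auto intro!: divide_right_mono)
    then show "t \<in> U" unfolding U_def using k M J by blast
  qed
  have "U \<in> sets lebesgue" unfolding U_def using I(1) fin by (auto intro!: sets.finite_UN)
  have "outer_measure_of lebesgue {t \<in> {0..T}. L t \<in> A} \<le> emeasure lebesgue U"
    using outer_measure_of_mono[OF \<open>_ \<subseteq> U\<close>, of lebesgue] \<open>U \<in> sets lebesgue\<close> by simp
  moreover have "emeasure lebesgue U < \<infinity>"
  proof -
    have "bounded U"
      unfolding U_def I_def using fin by (auto intro!: bounded_UN)
    then show ?thesis
      using \<open>U \<in> sets lebesgue\<close> by (metis bounded_set_imp_lmeasurable fmeasurableD2 infinity_ennreal_def less_top)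
  qed
  ultimately have "visiting_time L A T \<le> measure lebesgue U"
    unfolding visiting_time_def measure_def by (intro enn2real_mono) auto
  also have "\<dots> \<le> (\<Sum>k = 1..n. measure lebesgue (\<Union>(p, q)\<in>M k. \<Union>j\<in>J k p q. I j p))"
    unfolding U_def using I(1) fin by (intro measure_UNION_le) (auto intro!: sets.finite_UN)
  also have "\<dots> \<le> (\<Sum>k = 1..n. \<Sum>z\<in>M k. measure lebesgue (case z of (p, q) \<Rightarrow> \<Union>j\<in>J k p q. I j p))"
    using I(1) fin by (intro sum_mono measure_UNION_le) (auto intro!: sets.finite_UN)
  also have "\<dots> \<le> (\<Sum>k = 1..n. \<Sum>(p, q)\<in>M k. real (card (J k p q)) / (real (R\<^sup>2) * \<sigma>))"
  proof (intro sum_mono, clarify)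
    fix k p q
    have "measure lebesgue (\<Union>j\<in>J k p q. I j p) \<le> (\<Sum>j\<in>J k p q. measure lebesgue (I j p))"
      using I(1) fin by (intro measure_UNION_le) auto
    then show "measure lebesgue (\<Union>j\<in>J k p q. I j p) \<le> real (card (J k p q)) / (real (R\<^sup>2) * \<sigma>)"
      unfolding I(2) by simp
  qed
  finally show ?thesis unfolding M_def J_def .
qed

section \<open>Visiting frequencies\<close>

context badly_approximable_rotation
begin

text \<open>A cell that meets the set is entered at most as often as its square and its arc are visited together, and
  every crossing of its column lasts \<open>1 / (R\<^sup>2 \<sigma>)\<close>. As the mesh shrinks, the area of these cells tends to
  the area of the set, and the surplus length of the arcs becomes negligible compared with the rows.\<close>

lemma visiting_frequency_upper:
  assumes n: "1 \<le> n" and b: "0 < b" "b < 1" and b_orbit: "\<And>m :: int. b \<noteq> frac (of_int m * \<alpha>)"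
    and L: "half_infinite_geodesic n b \<alpha> L" and A: "surface_jordan_measurable n b A" and "0 < \<epsilon>"
  shows "\<forall>\<^sub>F T in at_top. visiting_time L A T / T \<le> surface_area n b A / n + \<epsilon>"
proof -
  define \<sigma> where "\<sigma> = 1 / sqrt (1 + \<alpha>\<^sup>2)"
  have "0 < 1 + \<alpha>\<^sup>2" by (simp add: add_pos_nonneg)
  then have \<sigma>: "0 < \<sigma>" unfolding \<sigma>_def by simp
  obtain l x a where l: "l \<in> {1..n}" and a: "0 \<le> a"
    and traj: "\<And>t. 0 \<le> t \<Longrightarrow> L t = surface_point n b (trajectory n b \<alpha> l x (a + \<sigma> * t))"
    using geodesic_eq_trajectory[OF b L] unfolding \<sigma>_def by metis
  define S where "S k = square_part n b A k" for k
  define area where "area = surface_area n b A"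
  have area_eq: "area = (\<Sum>k = 1..n. measure lebesgue (S k))" unfolding area_def surface_area_def S_def ..
  have area0: "0 \<le> area" unfolding area_eq by (intro sum_nonneg) simp
  have S: "bounded (S k)" "negligible (frontier (S k))" if "k \<in> {1..n}" for k
    using A that unfolding surface_jordan_measurable_def jordan_measurable_def S_def by auto
  define R0 where "R0 = nat \<lceil>8 * \<bar>\<alpha>\<bar> / \<epsilon> + 4 * \<bar>\<alpha>\<bar> + 2\<rceil>"
  have "\<forall>\<^sub>F R in sequentially. \<forall>k\<in>{1..n}. card (met_cells R k (S k)) / real R ^ 3 \<le> measure lebesgue (S k) + \<epsilon> / 4"
    using met_cells_area[OF S] \<open>0 < \<epsilon>\<close> by (intro eventually_ball_finite) auto
  then have "\<forall>\<^sub>F R in sequentially. R0 \<le> R \<and>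
      (\<forall>k\<in>{1..n}. card (met_cells R k (S k)) / real R ^ 3 \<le> measure lebesgue (S k) + \<epsilon> / 4)"
    by (intro eventually_conj eventually_ge_at_top)
  then obtain R where "R0 \<le> R"
    and cover: "\<And>k. k \<in> {1..n} \<Longrightarrow> card (met_cells R k (S k)) / real R ^ 3 \<le> measure lebesgue (S k) + \<epsilon> / 4"
    using eventually_happens'[OF sequentially_bot] by blast
  then have R_ge: "8 * \<bar>\<alpha>\<bar> / \<epsilon> + 4 * \<bar>\<alpha>\<bar> + 2 \<le> real R" unfolding R0_def by linarith
  have "0 \<le> 8 * \<bar>\<alpha>\<bar> / \<epsilon>" using \<open>0 < \<epsilon>\<close> by simp
  then have R: "2 \<le> real R" "4 * \<bar>\<alpha>\<bar> \<le> real R" "8 * \<bar>\<alpha>\<bar> / \<epsilon> \<le> real R" using R_ge by linarith+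
  have R_pos: "0 < R" using R(1) by simp
  define M where "M k = met_cells R k (S k)" for k
  have fin: "finite (M k)" for k unfolding M_def by (rule finite_met_cells)
  define d where "d = 1 / real R + 2 * \<bar>\<alpha>\<bar> / real (R\<^sup>2)"
  have "2 * \<bar>\<alpha>\<bar> / real R \<le> 1 / 2" using R(1,2) by (simp add: field_simps)
  then have "2 * \<bar>\<alpha>\<bar> / real R / real R \<le> 1 / 2 / real R" by (intro divide_right_mono) auto
  moreover have "1 / real R \<le> 1 / 2" using R(1) by (intro divide_left_mono) auto
  ultimately have "d \<le> 1" unfolding d_def by (simp add: power2_eq_square)
  moreover have "0 \<le> d" unfolding d_def by simp
  ultimately have d: "0 \<le> d" "d \<le> 1" by auto
  define X where "X = (\<Sum>k = 1..n. real (card (M k)) / real R ^ 3)"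
  have X_area: "X \<le> area + n * (\<epsilon> / 4)"
  proof -
    have "X \<le> (\<Sum>k = 1..n. measure lebesgue (S k) + \<epsilon> / 4)"
      unfolding X_def M_def using cover by (intro sum_mono) auto
    then show ?thesis by (simp add: sum.distrib area_eq)
  qed
  have X_n: "X \<le> n"
  proof -
    have "real (card (M k)) / real R ^ 3 \<le> 1" for k
    proof -
      have "card (M k) \<le> card ({..<R\<^sup>2} \<times> {..<R})"
        unfolding M_def met_cells_def by (intro card_mono) auto
      then have "real (card (M k)) \<le> real (R\<^sup>2 * R)" by (simp add: card_cartesian_product del: of_nat_mult)
      then show ?thesis using R_pos by (simp add: power2_eq_square power3_eq_cube)
    qed
    then have "X \<le> (\<Sum>k = 1..n. 1)" unfolding X_def by (intro sum_mono) auto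
    then show ?thesis by simp
  qed
  define \<delta> where "\<delta> = \<epsilon> / (4 * n * R)"
  have \<delta>: "0 < \<delta>" unfolding \<delta>_def using \<open>0 < \<epsilon>\<close> n R_pos by simp
  define s where "s p q = real q / real R - \<alpha> * (real p / real (R\<^sup>2)) - \<bar>\<alpha>\<bar> / real (R\<^sup>2)" for p q
  define J where "J N k p q = {j. j < N \<and> visited_square n b \<alpha> l x j = k \<and> frac (x + real j * \<alpha> - s p q) < d}" for N k p q
  have "\<forall>\<^sub>F N in sequentially. \<forall>k\<in>{1..n}. \<forall>z\<in>M k. case z of (p, q) \<Rightarrow> real (card (J N k p q)) \<le> (d / n + \<delta>) * N"
    using visits_to_square_upper[OF n b b_orbit l _ d \<delta>] fin unfolding J_def
    by (intro eventually_ball_finite ballI) auto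
  then obtain N0 where N0: "\<And>N k p q. N0 \<le> N \<Longrightarrow> k \<in> {1..n} \<Longrightarrow> (p, q) \<in> M k \<Longrightarrow>
      real (card (J N k p q)) \<le> (d / n + \<delta>) * N"
    unfolding eventually_sequentially by fast
  define C where "C = area / n + 3 / 4 * \<epsilon>"
  have C: "0 \<le> C" unfolding C_def using area0 \<open>0 < \<epsilon>\<close> by simp
  have rate: "X * R * (d / n + \<delta>) \<le> C"
  proof -
    have "2 * \<bar>\<alpha>\<bar> / R \<le> \<epsilon> / 4" using R(1,3) \<open>0 < \<epsilon>\<close> by (simp add: field_simps)
    have X0: "0 \<le> X" unfolding X_def by (intro sum_nonneg) simp
    have "X * R * (d / n + \<delta>) = X / n + X / n * (2 * \<bar>\<alpha>\<bar> / R) + X / n * (\<epsilon> / 4)"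
      unfolding d_def \<delta>_def using R_pos n by (simp add: field_simps power2_eq_square)
    also have "\<dots> \<le> (area / n + \<epsilon> / 4) + 1 * (\<epsilon> / 4) + 1 * (\<epsilon> / 4)"
    proof (intro add_mono mult_mono)
      show "X / n \<le> area / n + \<epsilon> / 4" using X_area n by (simp add: field_simps)
      show "X / n \<le> 1" "X / n \<le> 1" using X_n n by (simp_all add: field_simps)
    qed (use \<open>2 * \<bar>\<alpha>\<bar> / R \<le> \<epsilon> / 4\<close> X0 \<open>0 < \<epsilon>\<close> in auto)
    finally show ?thesis unfolding C_def by simp
  qed
  have bound: "visiting_time L A T / T \<le> area / n + \<epsilon>"
    if T: "max 1 (max (N0 / \<sigma>) (4 * C * (a + 1) / (\<sigma> * \<epsilon>))) \<le> T" for T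
  proof -
    have T1: "0 < T" and TN: "N0 / \<sigma> \<le> T" and TC: "4 * C * (a + 1) / (\<sigma> * \<epsilon>) \<le> T" using T by auto
    define N where "N = Suc (nat \<lfloor>a + \<sigma> * T\<rfloor>)"
    have "0 \<le> a + \<sigma> * T" using a \<sigma> T1 by simp
    then have N_le: "real N \<le> a + \<sigma> * T + 1" and N_ge: "a + \<sigma> * T \<le> real N" unfolding N_def by linarith+
    have "real N0 \<le> \<sigma> * T" using TN \<sigma> by (simp add: field_simps)
    then have "N0 \<le> N" using N_ge a by linarith
    have "visiting_time L A T \<le> (\<Sum>k = 1..n. \<Sum>(p, q)\<in>M k. real (card (J N k p q)) / (real (R\<^sup>2) * \<sigma>))"
      using visiting_time_le_cells[OF \<sigma> a l R_pos less_imp_le[OF T1] traj, of A]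
      unfolding M_def S_def J_def N_def s_def d_def .
    also have "\<dots> \<le> (\<Sum>k = 1..n. \<Sum>(p, q)\<in>M k. (d / n + \<delta>) * N / (real (R\<^sup>2) * \<sigma>))"
      using N0[OF \<open>N0 \<le> N\<close>] \<sigma> by (intro sum_mono) (auto intro!: divide_right_mono)
    also have "\<dots> = X * R * (d / n + \<delta>) * (N / \<sigma>)"
      unfolding X_def sum_distrib_right using R_pos
      by (intro sum.cong) (auto simp: split_def power2_eq_square power3_eq_cube field_simps)
    also have "\<dots> \<le> C * (N / \<sigma>)" using rate \<sigma> by (intro mult_right_mono) auto
    also have "\<dots> \<le> C * ((a + \<sigma> * T + 1) / \<sigma>)" using N_le C \<sigma> by (intro mult_left_mono divide_right_mono) auto
    also have "\<dots> = C * T + C * (a + 1) / \<sigma>" using \<sigma> by (simp add: field_simps)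
    also have "C * (a + 1) / \<sigma> \<le> \<epsilon> / 4 * T" using TC \<sigma> \<open>0 < \<epsilon>\<close> by (simp add: field_simps)
    finally have "visiting_time L A T \<le> (C + \<epsilon> / 4) * T" by (simp add: algebra_simps)
    then have "visiting_time L A T / T \<le> C + \<epsilon> / 4" using T1 by (simp add: pos_divide_le_eq)
    then show ?thesis unfolding C_def by simp
  qed
  show ?thesis
    unfolding area_def[symmetric] by (rule eventually_mono[OF eventually_ge_at_top bound])
qed

end

lemma measure_square: "measure lebesgue (square k) = 1"
proof -
  have "square k = cbox (real k - 1, 0) (real k, 1)" unfolding square_def cbox_Pair_eq by simp
  then show ?thesis by (simp add: content_Pair)
qed

text \<open>Passing to the complement turns upper bounds for visiting frequencies into lower bounds.\<close>

lemma surface_complement: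
  assumes A: "surface_jordan_measurable n b A"
  shows "surface_jordan_measurable n b (square_surface n b - A)"
    and "surface_area n b (square_surface n b - A) = n - surface_area n b A"
proof -
  have part: "square_part n b (square_surface n b - A) k = square k - square_part n b A k" if "k \<in> {1..n}" for k
    using that unfolding square_part_def square_surface_def by auto
  have sq: "square k = {real k - 1..real k} \<times> {0..1}" for k unfolding square_def ..
  have sq_bounded: "bounded (square k)" for k unfolding sq by (intro bounded_Times) auto
  have sq_convex: "convex (square k)" for k unfolding sq by (intro convex_Times) auto
  have S: "bounded (square_part n b A k)" "negligible (frontier (square_part n b A k))" if "k \<in> {1..n}" for k
    using A that unfolding surface_jordan_measurable_def jordan_measurable_def by auto
  have "jordan_measurable (square k - square_part n b A k)" if "k \<in> {1..n}" for k
    unfolding jordan_measurable_def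
  proof
    show "bounded (square k - square_part n b A k)" by (rule bounded_diff[OF sq_bounded])
    have "negligible (frontier (square k) \<union> frontier (square_part n b A k))"
      using S(2)[OF that] negligible_convex_frontier[OF sq_convex] by (rule negligible_Un[rotated])
    moreover have "frontier (square k - square_part n b A k) \<subseteq> frontier (square k) \<union> frontier (square_part n b A k)"
      using frontier_Int_subset[of "square k" "- square_part n b A k"] by (simp add: Diff_eq)
    ultimately show "negligible (frontier (square k - square_part n b A k))" by (rule negligible_subset)
  qed
  then show "surface_jordan_measurable n b (square_surface n b - A)"
    unfolding surface_jordan_measurable_def using part by auto
  have "measure lebesgue (square k - square_part n b A k) = 1 - measure lebesgue (square_part n b A k)"
    if "k \<in> {1..n}" for k
  proof -
    have "square k \<in> lmeasurable"
      using sq_bounded negligible_convex_frontier[OF sq_convex] by (rule measurable_Jordan)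
    moreover have "square_part n b A k \<in> lmeasurable" using S[OF that] by (rule measurable_Jordan)
    ultimately have "measure lebesgue (square k - square_part n b A k) =
        measure lebesgue (square k) - measure lebesgue (square_part n b A k)"
      by (intro measurable_measure_Diff) (auto simp: square_part_def)
    then show ?thesis unfolding measure_square .
  qed
  then show "surface_area n b (square_surface n b - A) = n - surface_area n b A"
    unfolding surface_area_def using part by (simp add: sum_subtractf)
qed

lemma visiting_time_complement:
  assumes "0 \<le> T" and "\<And>t. 0 \<le> t \<Longrightarrow> L t \<in> A \<union> B"
  shows "T \<le> visiting_time L A T + visiting_time L B T"
proof -
  define P where "P A = {t \<in> {0..T}. L t \<in> A}" for A
  have fin: "outer_measure_of lebesgue (P A) < top" for A
  proof -
    have "outer_measure_of lebesgue (P A) \<le> outer_measure_of lebesgue {0..T}"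
      by (rule outer_measure_of_mono) (auto simp: P_def)
    also have "\<dots> = ennreal T" using assms(1) by simp
    finally show ?thesis by (rule le_less_trans) simp
  qed
  obtain E where E: "E \<in> sets lebesgue" "P A \<subseteq> E" "outer_measure_of lebesgue (P A) = emeasure lebesgue E"
    using outer_measure_of_attain[of "P A" lebesgue] by auto
  obtain F where F: "F \<in> sets lebesgue" "P B \<subseteq> F" "outer_measure_of lebesgue (P B) = emeasure lebesgue F"
    using outer_measure_of_attain[of "P B" lebesgue] by auto
  have "{0..T} \<subseteq> E \<union> F" using assms(2) E(2) F(2) unfolding P_def by fastforce
  then have "emeasure lebesgue {0..T} \<le> emeasure lebesgue (E \<union> F)" using E(1) F(1) by (intro emeasure_mono) auto
  also have "\<dots> \<le> emeasure lebesgue E + emeasure lebesgue F" using E(1) F(1) by (rule emeasure_subadditive)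
  finally have "ennreal T \<le> outer_measure_of lebesgue (P A) + outer_measure_of lebesgue (P B)"
    using assms(1) E(3) F(3) by simp
  then have "enn2real (ennreal T) \<le> enn2real (outer_measure_of lebesgue (P A) + outer_measure_of lebesgue (P B))"
    using fin by (intro enn2real_mono) auto
  then show ?thesis
    using assms(1) fin unfolding visiting_time_def P_def by (simp add: enn2real_plus)
qed

lemma geodesic_in_surface:
  assumes "half_infinite_geodesic n b \<alpha> L" and "0 \<le> t"
  shows "L t \<in> square_surface n b"
proof -
  have "\<exists>\<epsilon>>0. \<exists>l\<in>{1..n}. \<exists>p. \<forall>s\<in>{0..\<epsilon>}. p + s *\<^sub>R unit_direction \<alpha> \<in> square l \<and>
      L (t + s) = surface_point n b (l, p + s *\<^sub>R unit_direction \<alpha>)"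
    using conjunct1[OF assms(1)[unfolded half_infinite_geodesic_def]] assms(2) by (elim allE impE)
  then obtain \<epsilon> l p where \<epsilon>: "0 < \<epsilon>" "l \<in> {1..n}" and
    seg: "\<And>s. s \<in> {0..\<epsilon>} \<Longrightarrow> p + s *\<^sub>R unit_direction \<alpha> \<in> square l \<and>
      L (t + s) = surface_point n b (l, p + s *\<^sub>R unit_direction \<alpha>)" by (elim exE conjE bexE) metis
  have "p \<in> square l" "L t = surface_point n b (l, p)" using seg[of 0] \<epsilon>(1) by auto
  then show ?thesis unfolding square_surface_def using \<epsilon>(2) by auto
qed

theorem theorem3p1:
  fixes n :: nat and \<alpha> b :: real and L :: "real \<Rightarrow> square_point set"
  assumes "n \<ge> 2"
    and "badly_approximable \<alpha>"
    and "0 < b" and "b < 1"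
    and "\<And>m :: int. b \<noteq> frac (of_int m * \<alpha>)"
    and "half_infinite_geodesic n b \<alpha> L"
  shows "uniformly_distributed n b L"
  unfolding uniformly_distributed_def
proof (intro allI impI)
  fix A assume A: "surface_jordan_measurable n b A"
  obtain c where c: "0 < c" "\<And>m k :: int. m \<noteq> 0 \<Longrightarrow> c / \<bar>of_int m\<bar> \<le> \<bar>of_int m * \<alpha> - of_int k\<bar>"
    using badly_approximable_lower_bound[OF assms(2)] by metis
  interpret badly_approximable_rotation \<alpha> c by unfold_locales (use c in auto)
  define B where "B = square_surface n b - A"
  have n: "1 \<le> n" using assms(1) by simp
  note upper = visiting_frequency_upper[OF n assms(3-6)]
  show "((\<lambda>T. visiting_time L A T / T) \<longlongrightarrow> surface_area n b A / real n) at_top"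
  proof (rule tendstoI)
    fix \<epsilon> :: real assume "0 < \<epsilon>"
    then have half: "0 < \<epsilon> / 2" by simp
    show "\<forall>\<^sub>F T in at_top. dist (visiting_time L A T / T) (surface_area n b A / real n) < \<epsilon>"
      using upper[OF A half] upper[OF surface_complement(1)[OF A] half] eventually_gt_at_top[of 0]
    proof eventually_elim
      case (elim T)
      have "T \<le> visiting_time L A T + visiting_time L B T"
        using elim(3) geodesic_in_surface[OF assms(6)] unfolding B_def by (intro visiting_time_complement) auto
      then have "1 \<le> visiting_time L A T / T + visiting_time L B T / T"
        using elim(3) by (simp add: field_simps)
      moreover have "surface_area n b B / n = 1 - surface_area n b A / n"
        unfolding B_def surface_complement(2)[OF A] using n by (simp add: diff_divide_distrib)
      ultimately have "\<bar>visiting_time L A T / T - surface_area n b A / n\<bar> \<le> \<epsilon> / 2"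
        using elim(1,2) unfolding B_def[symmetric] by linarith
      then show ?case using \<open>0 < \<epsilon>\<close> by (simp add: dist_real_def)
    qed
  qed
qed

end
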